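(* Let $\mathcal{M}\subset\mathcal{B}(\mathfrak{H})$ be a finite-dimensional von Neumann algebra and let $\mathcal{L}_\gamma=\mathcal{L}_A+\gamma\mathcal{L}_S$, $\gamma>0$, be a family of quantum Markov semigroup generators on $\mathcal{M}$, with $\mathcal{L}_A,\mathcal{L}_S$ independent of $\gamma$, such that: (A) $\mathcal{L}_S=\mathcal{L}_S^\star$ and $\mathcal{L}_A=-\mathcal{L}_A^\star$ for the $\sigma$-KMS inner product of some full-rank state $\sigma\in\mathcal{D}_+(\mathcal{M})$; (B) $\dim\mathcal{F}(\mathcal{L}_S)>\dim\mathcal{F}(\mathcal{L}_\gamma)$; (C) $E_S\mathcal{L}_AE_S=0$. For $\varepsilon>0$ let $X^\varepsilon$ solve $$\frac{\mathrm d}{\mathrm dt}X^\varepsilon(t)=(\varepsilon^{-1}\mathcal{L}_A+\varepsilon^{-2}\mathcal{L}_S)X^\varepsilon(t),$$ and let $X_0$ solve $$\frac{\mathrm d}{\mathrm dt}X_0(t)=-(\mathcal{L}_AE_S)^\star(-\mathcal{L}_S)^{-1}(\mathcal{L}_AE_S)X_0(t),$$ with $X^\varepsilon(0)=X_0(0)\in\mathcal{F}(\mathcal{L}_S)$ independent of $\varepsilon$. Then for any $t\ge0$, $\|X^\varepsilon(t)-X_0(t)\|_{2,\sigma}=\mathcal{O}(\varepsilon)$ as $\varepsilon\to0$.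
   Context: $\mathfrak{H}$ is a finite-dimensional Hilbert space. A quantum Markov semigroup on $\mathcal{M}$ is a semigroup $\exp(t\mathcal{L})$ of completely positive unital maps $\mathcal{M}\to\mathcal{M}$. $\mathcal{D}_+(\mathcal{M})$ is the set of full-rank density operators in $\mathcal{M}$. The $\sigma$-KMS inner product is $\langle X,Y\rangle_{\sigma,1/2}=\mathrm{tr}(\sigma^{1/2}X^*\sigma^{1/2}Y)$, with induced norm $\|\cdot\|_{2,\sigma}$; $\Phi^\star$ is the adjoint of a linear map $\Phi$ for it. $\mathcal{F}(\mathcal{L})=\ker\mathcal{L}$ is the fixed-point algebra. $E_S$ is the conditional expectation with respect to $\sigma$ (equivalently the KMS-orthogonal projection) from $\mathcal{M}$ onto $\mathcal{F}(\mathcal{L}_S)$. $(-\mathcal{L}_S)^{-1}$ denotes the pseudoinverse. The implied constant in $\mathcal{O}(\varepsilon)$ may depend on $t$, $X_0(0)$ and the operators, but not on $\varepsilon$. *)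

theory Defs
  imports "HOL-Analysis.Analysis" "HOL-Library.Landau_Symbols"
begin

text \<open>
  Operators on the \<open>n\<close>-dimensional Hilbert space \<open>\<complex>\<^sup>n\<close> are matrices \<open>complex ^ 'n ^ 'n\<close>. A linear map on
  a von Neumann algebra \<open>M\<close> is a function on all matrices of which only the values on \<open>M\<close> matter.
\<close>

type_synonym 'n cmat = "complex ^ 'n ^ 'n"

definition hinner :: "complex ^ 'n \<Rightarrow> complex ^ 'n \<Rightarrow> complex" where
  "hinner v w = (\<Sum>i\<in>UNIV. cnj (v $ i) * w $ i)"

definition hadj :: "'n::finite cmat \<Rightarrow> 'n cmat" where
  "hadj A = transpose (map_matrix cnj A)"

text \<open>Complex scalar multiplication; \<open>*\<^sub>R\<close> on matrices is only real.\<close>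

definition cscale :: "complex \<Rightarrow> 'n::finite cmat \<Rightarrow> 'n cmat" where
  "cscale c A = map_matrix (\<lambda>z. c * z) A"

lemma vector_space_cscale: "vector_space cscale"
  by unfold_locales (auto simp: cscale_def vec_eq_iff algebra_simps)

definition cdim :: "'n::finite cmat set \<Rightarrow> nat" where
  "cdim = vector_space.dim cscale"

text \<open>On a complex Hilbert space \<open>\<langle>v, A v\<rangle> \<ge> 0\<close> for all \<open>v\<close> includes \<open>A = A\<^sup>*\<close>.\<close>

definition psd :: "'n::finite cmat \<Rightarrow> bool" where
  "psd A \<longleftrightarrow> (\<forall>v. hinner v (A *v v) \<in> \<real>\<^sub>\<ge>\<^sub>0)"

definition psd_sqrt :: "'n::finite cmat \<Rightarrow> 'n cmat" where
  "psd_sqrt A = (THE R. psd R \<and> R ** R = A)"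

text \<open>All operator topologies agree in finite dimension, so \<open>closed\<close> is closedness in the weak
  operator topology.\<close>

definition von_neumann_algebra :: "'n::finite cmat set \<Rightarrow> bool" where
  "von_neumann_algebra M \<longleftrightarrow>
     mat 1 \<in> M \<and> closed M \<and>
     (\<forall>A\<in>M. \<forall>B\<in>M. A + B \<in> M \<and> A ** B \<in> M) \<and>
     (\<forall>A\<in>M. hadj A \<in> M \<and> (\<forall>c. cscale c A \<in> M))"

definition full_rank_densities :: "'n::finite cmat set \<Rightarrow> 'n cmat set" where
  "full_rank_densities M = {\<sigma> \<in> M. psd \<sigma> \<and> trace \<sigma> = 1 \<and> rank \<sigma> = CARD('n)}"

definition linear_map :: "'n::finite cmat set \<Rightarrow> ('n cmat \<Rightarrow> 'n cmat) \<Rightarrow> bool" where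
  "linear_map M \<Phi> \<longleftrightarrow>
     (\<forall>X\<in>M. \<Phi> X \<in> M) \<and>
     (\<forall>X\<in>M. \<forall>Y\<in>M. \<Phi> (X + Y) = \<Phi> X + \<Phi> Y) \<and>
     (\<forall>X\<in>M. \<forall>c. \<Phi> (cscale c X) = cscale c (\<Phi> X))"

text \<open>Positivity of the \<open>m \<times> m\<close> block operator with entries \<open>X i j\<close>, \<open>i, j < m\<close>, on the \<open>m\<close>-fold direct
  sum of the Hilbert space.\<close>

definition block_psd :: "nat \<Rightarrow> (nat \<Rightarrow> nat \<Rightarrow> 'n::finite cmat) \<Rightarrow> bool" where
  "block_psd m X \<longleftrightarrow>
     (\<forall>v :: nat \<Rightarrow> complex ^ 'n. (\<Sum>i<m. \<Sum>j<m. hinner (v i) (X i j *v v j)) \<in> \<real>\<^sub>\<ge>\<^sub>0)"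

definition completely_positive :: "'n::finite cmat set \<Rightarrow> ('n cmat \<Rightarrow> 'n cmat) \<Rightarrow> bool" where
  "completely_positive M \<Phi> \<longleftrightarrow>
     (\<forall>m X. (\<forall>i<m. \<forall>j<m. X i j \<in> M) \<and> block_psd m X \<longrightarrow> block_psd m (\<lambda>i j. \<Phi> (X i j)))"

definition semigroup_exp :: "('n::finite cmat \<Rightarrow> 'n cmat) \<Rightarrow> real \<Rightarrow> 'n cmat \<Rightarrow> 'n cmat" where
  "semigroup_exp L t X = (\<Sum>k. (t ^ k / fact k) *\<^sub>R (L ^^ k) X)"

definition qms_generator :: "'n::finite cmat set \<Rightarrow> ('n cmat \<Rightarrow> 'n cmat) \<Rightarrow> bool" where
  "qms_generator M L \<longleftrightarrow>
     linear_map M L \<and>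
     (\<forall>t\<ge>0. completely_positive M (semigroup_exp L t) \<and> semigroup_exp L t (mat 1) = mat 1)"

definition fixed_points :: "'n::finite cmat set \<Rightarrow> ('n cmat \<Rightarrow> 'n cmat) \<Rightarrow> 'n cmat set" where
  "fixed_points M L = {X \<in> M. L X = 0}"

definition kms_inner :: "'n::finite cmat \<Rightarrow> 'n cmat \<Rightarrow> 'n cmat \<Rightarrow> complex" where
  "kms_inner \<sigma> X Y = trace (psd_sqrt \<sigma> ** hadj X ** psd_sqrt \<sigma> ** Y)"

definition kms_norm :: "'n::finite cmat \<Rightarrow> 'n cmat \<Rightarrow> real" where
  "kms_norm \<sigma> X = sqrt (Re (kms_inner \<sigma> X X))"

definition kms_adjoint ::
    "'n::finite cmat set \<Rightarrow> 'n cmat \<Rightarrow> ('n cmat \<Rightarrow> 'n cmat) \<Rightarrow> 'n cmat \<Rightarrow> 'n cmat" where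
  "kms_adjoint M \<sigma> \<Phi> Y =
     (THE Z. Z \<in> M \<and> (\<forall>X\<in>M. kms_inner \<sigma> (\<Phi> X) Y = kms_inner \<sigma> X Z))"

text \<open>Conditional expectations from \<open>M\<close> onto a unital *-subalgebra \<open>N\<close> that preserve \<open>\<sigma>\<close>. The
  unit and module properties give \<open>E A = A\<close> for \<open>A \<in> N\<close>.\<close>

definition is_cond_exp ::
    "'n::finite cmat set \<Rightarrow> 'n cmat \<Rightarrow> 'n cmat set \<Rightarrow> ('n cmat \<Rightarrow> 'n cmat) \<Rightarrow> bool" where
  "is_cond_exp M \<sigma> N E \<longleftrightarrow>
     linear_map M E \<and>
     (\<forall>X\<in>M. E X \<in> N) \<and>
     (\<forall>X\<in>M. psd X \<longrightarrow> psd (E X)) \<and>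
     E (mat 1) = mat 1 \<and>
     (\<forall>A\<in>N. \<forall>B\<in>N. \<forall>X\<in>M. E (A ** X ** B) = A ** E X ** B) \<and>
     (\<forall>X\<in>M. trace (\<sigma> ** E X) = trace (\<sigma> ** X))"

text \<open>For a full-rank state \<open>\<sigma>\<close> a \<open>\<sigma>\<close>-preserving conditional expectation is unique on \<open>M\<close>; the choice
  operator only fixes the irrelevant values outside \<open>M\<close>. The same holds for the pseudoinverse below.\<close>

definition cond_exp ::
    "'n::finite cmat set \<Rightarrow> 'n cmat \<Rightarrow> 'n cmat set \<Rightarrow> 'n cmat \<Rightarrow> 'n cmat" where
  "cond_exp M \<sigma> N = (SOME E. is_cond_exp M \<sigma> N E)"

text \<open>The Moore-Penrose inverse on \<open>M\<close> with the KMS inner product, by the four Penrose equations.\<close>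

definition is_pseudoinverse ::
    "'n::finite cmat set \<Rightarrow> 'n cmat \<Rightarrow> ('n cmat \<Rightarrow> 'n cmat) \<Rightarrow> ('n cmat \<Rightarrow> 'n cmat) \<Rightarrow> bool" where
  "is_pseudoinverse M \<sigma> \<Phi> T \<longleftrightarrow>
     linear_map M T \<and>
     (\<forall>X\<in>M. \<Phi> (T (\<Phi> X)) = \<Phi> X \<and> T (\<Phi> (T X)) = T X \<and>
        kms_adjoint M \<sigma> (\<Phi> \<circ> T) X = \<Phi> (T X) \<and> kms_adjoint M \<sigma> (T \<circ> \<Phi>) X = T (\<Phi> X))"

definition pseudoinverse ::
    "'n::finite cmat set \<Rightarrow> 'n cmat \<Rightarrow> ('n cmat \<Rightarrow> 'n cmat) \<Rightarrow> 'n cmat \<Rightarrow> 'n cmat" where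
  "pseudoinverse M \<sigma> \<Phi> = (SOME T. is_pseudoinverse M \<sigma> \<Phi> T)"

end

theory Submission
  imports Defs
begin

text \<open>
  The theorem is a singular perturbation result: the fast dissipation \<open>\<epsilon>\<^sup>-\<^sup>2 L\<^sub>S\<close> confines the dynamics to
  the kernel of \<open>L\<^sub>S\<close>, where the drift \<open>L\<^sub>A\<close> averages to zero at first order by \<open>E\<^sub>S L\<^sub>A E\<^sub>S = 0\<close>, and what
  survives is its second-order effect. Put \<open>T = (- L\<^sub>S)\<^sup>-\<^sup>1\<close>, \<open>X\<^sub>1 = T L\<^sub>A X\<^sub>0\<close> and
  \<open>X\<^sub>2 = T (L\<^sub>A X\<^sub>1 - X\<^sub>0')\<close>. Then \<open>X\<^sub>0 + \<epsilon> X\<^sub>1 + \<epsilon>\<^sup>2 X\<^sub>2\<close> solves the equation of \<open>X\<^sup>\<epsilon>\<close> up to a residual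
  of order \<open>\<epsilon>\<close>. In the KMS norm \<open>L\<^sub>A\<close> is skew and \<open>L\<^sub>S\<close> is dissipative, so Gronwall's inequality bounds the
  difference by a multiple of the residual and of the initial error, both of order \<open>\<epsilon>\<close>
  (\<open>diffusive_averaging\<close>).

  The remaining work is to show that the objects of the statement have the properties that this
  argument uses. The square root of \<open>\<sigma>\<close> exists and is unique (\<open>psd_sqrt_works\<close>), and conjugation
  by \<open>\<sigma>\<^bsup>1/4\<^esup>\<close> turns the KMS inner product into the Hilbert-Schmidt one; KMS adjoints and the orthogonal
  decomposition into kernel and range of \<open>L\<^sub>S\<close> thus come from Euclidean linear algebra.

  The structure of \<open>L\<^sub>S\<close> itself comes from complete positivity. Only the maps \<open>L\<^sub>A + \<gamma> L\<^sub>S\<close> are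
  assumed to generate semigroups. Differentiating complete positivity at time zero gives an inequality
  that is affine in \<open>\<gamma>\<close> (\<open>conditionally_cp\<close>), and letting \<open>\<gamma>\<close> grow gives the same inequality for \<open>L\<^sub>S\<close>
  alone, without any semigroup generated by \<open>L\<^sub>S\<close>. It says that \<open>L\<^sub>S\<close> preserves adjoints, has a positive
  carre du champ and satisfies a minimum principle. As \<open>L\<^sub>S\<close> is KMS-symmetric and kills the unit,
  \<open>tr (\<sigma> L\<^sub>S X) = 0\<close>; so the carre du champ vanishes on fixed points, which form an algebra over which \<open>L\<^sub>S\<close>
  is a bimodule map (\<open>generator_module_left\<close>). Therefore the orthogonal projection onto the fixed points is
  a conditional expectation, positive by the minimum principle (\<open>proj_psd\<close>), and it is the only one.
  Dissipativity holds first for the form \<open>tr (\<sigma> X\<^sup>* X)\<close>, which fixes the sign of the eigenvalues, and then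
  in the KMS inner product because \<open>L\<^sub>S\<close> is symmetric there.
\<close>

section \<open>Matrices and the Hilbert-Schmidt inner product\<close>

lemma hinner_add [simp]:
  "hinner (u + v) w = hinner u w + hinner v w" "hinner u (v + w) = hinner u v + hinner u w"
  by (auto simp: hinner_def sum.distrib algebra_simps)

lemma hinner_diff [simp]:
  "hinner (u - v) w = hinner u w - hinner v w" "hinner u (v - w) = hinner u v - hinner u w"
  by (auto simp: hinner_def sum_subtractf algebra_simps)

lemma hinner_scale [simp]:
  "hinner (c *s v) w = cnj c * hinner v w" "hinner v (c *s w) = c * hinner v w"
  by (auto simp: hinner_def sum_distrib_left algebra_simps)

lemma hinner_zero [simp]: "hinner 0 w = 0" "hinner v 0 = 0"
  by (auto simp: hinner_def)

lemma hinner_uminus [simp]: "hinner (- v) w = - hinner v w" "hinner v (- w) = - hinner v w"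
  by (auto simp: hinner_def sum_negf)

lemma cnj_hinner: "cnj (hinner v w) = hinner w v"
  by (simp add: hinner_def mult.commute)

lemma Re_hinner: "Re (hinner v w) = inner v w"
  by (simp add: hinner_def inner_vec_def inner_complex_def)

lemma hinner_self: "hinner v v = complex_of_real ((norm v)\<^sup>2)"
proof (rule complex_eqI)
  have "Im (hinner v v) = Im (cnj (hinner v v))" by (subst cnj_hinner) simp
  then show "Im (hinner v v) = Im (complex_of_real ((norm v)\<^sup>2))" by simp
  show "Re (hinner v v) = Re (complex_of_real ((norm v)\<^sup>2))"
    unfolding Re_hinner by (simp add: power2_norm_eq_inner)
qed

lemma hinner_adj: "hinner v (A *v w) = hinner (hadj A *v v) w"
  unfolding hinner_def matrix_vector_mult_def hadj_def
  apply (simp add: sum_distrib_left sum_distrib_right transpose_def map_matrix_def)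
  apply (subst sum.swap)
  apply (simp add: mult_ac)
  done

lemma hinner_axis: "hinner (axis i 1) v = v $ i"
  by (simp add: hinner_def axis_def if_distrib[of cnj] if_distrib[of "\<lambda>x. x * _"] cong: if_cong)

lemma hadj_component: "hadj A $ i $ j = cnj (A $ j $ i)"
  by (simp add: hadj_def transpose_def map_matrix_def)

lemma cscale_component: "cscale c A $ i $ j = c * A $ i $ j"
  by (simp add: cscale_def map_matrix_def)

lemma hadj_hadj [simp]: "hadj (hadj A) = A"
  and hadj_add: "hadj (A + B) = hadj A + hadj B"
  and hadj_diff: "hadj (A - B) = hadj A - hadj B"
  and hadj_cscale: "hadj (cscale c A) = cscale (cnj c) (hadj A)"
  and hadj_scaleR: "hadj (r *\<^sub>R A) = r *\<^sub>R hadj A"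
  and hadj_one [simp]: "hadj (mat 1) = mat 1"
  and hadj_zero [simp]: "hadj 0 = 0"
  by (auto simp: vec_eq_iff hadj_component cscale_component mat_def)

lemma hadj_mult: "hadj (A ** B) = hadj B ** hadj A"
  by (simp add: vec_eq_iff hadj_component matrix_matrix_mult_def mult.commute)

lemma cscale_mult: "cscale c A ** B = cscale c (A ** B)" "A ** cscale c B = cscale c (A ** B)"
  by (auto simp: vec_eq_iff cscale_component matrix_matrix_mult_def sum_distrib_left mult_ac)

lemma cscale_vec: "cscale c A *v v = c *s (A *v v)"
  by (auto simp: vec_eq_iff cscale_component matrix_vector_mult_def sum_distrib_left mult_ac)

lemma scaleR_eq_cscale: "r *\<^sub>R A = cscale (of_real r) (A :: 'n::finite cmat)"
  by (simp add: vec_eq_iff cscale_component) (simp add: scaleR_conv_of_real)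

lemma scaleR_mult:
  fixes A B :: "'n::finite cmat"
  shows "(r *\<^sub>R A) ** B = r *\<^sub>R (A ** B)" "A ** (r *\<^sub>R B) = r *\<^sub>R (A ** B)"
  by (auto simp: scaleR_eq_cscale cscale_mult)

lemma scaleR_vec: "(r *\<^sub>R (A :: 'n::finite cmat)) *v v = r *\<^sub>R (A *v v)"
  by (simp add: scaleR_eq_cscale cscale_vec vec_eq_iff) (simp add: scaleR_conv_of_real)

lemma uminus_eq_cscale: "- A = cscale (-1) A"
  by (simp add: vec_eq_iff cscale_component)

lemma cscale_one [simp]: "cscale 1 A = A"
  and cscale_zero [simp]: "cscale c 0 = 0" "cscale 0 A = 0"
  and cscale_cscale: "cscale c (cscale d A) = cscale (c * d) A"
  and cscale_add: "cscale c (A + B) = cscale c A + cscale c B"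
  and cscale_diff: "cscale c (A - B) = cscale c A - cscale c B"
  by (auto simp: vec_eq_iff cscale_component algebra_simps)

lemma matrix_add_rdistrib: "(A + B) ** C = A ** C + B ** (C :: 'n::finite cmat)"
  by (auto simp: vec_eq_iff matrix_matrix_mult_def sum.distrib algebra_simps)

lemma matrix_diff_distrib:
  "A ** (B - C) = A ** B - A ** C" "(A - B) ** C = A ** C - B ** (C :: 'n::finite cmat)"
  by (auto simp: vec_eq_iff matrix_matrix_mult_def sum_subtractf algebra_simps)

lemma matrix_zero_mult [simp]: "A ** 0 = 0" "0 ** (A :: 'n::finite cmat) = 0"
  by (auto simp: vec_eq_iff matrix_matrix_mult_def)

lemma uminus_vec: "(- A) *v v = - (A *v (v :: complex ^ 'n::finite))"
  by (auto simp: vec_eq_iff matrix_vector_mult_def sum_negf)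

lemmas matrix_distrib = matrix_add_ldistrib matrix_add_rdistrib matrix_diff_distrib

lemma trace_cscale: "trace (cscale c A) = c * trace A"
  by (simp add: trace_def cscale_component sum_distrib_left)

lemma trace_hadj: "trace (hadj A) = cnj (trace A)"
  by (simp add: trace_def hadj_component)

lemma trace_zero [simp]: "trace (0 :: 'n::finite cmat) = 0"
  by (simp add: trace_def)

lemma inner_eq_trace: "inner X Y = Re (trace (hadj X ** Y))"
proof -
  have "Re (trace (hadj X ** Y)) = (\<Sum>i\<in>UNIV. \<Sum>j\<in>UNIV. inner (X $ j $ i) (Y $ j $ i))"
    by (simp add: trace_def matrix_matrix_mult_def hadj_component inner_complex_def)
  also have "\<dots> = inner X Y"
    by (subst sum.swap) (simp add: inner_vec_def)
  finally show ?thesis by simp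
qed

lemma trace_hadj_self: "trace (hadj X ** X) = complex_of_real ((norm X)\<^sup>2)"
proof (rule complex_eqI)
  have "cnj (trace (hadj X ** X)) = trace (hadj X ** X)"
    by (subst trace_hadj[symmetric]) (simp add: hadj_mult)
  then have "Im (cnj (trace (hadj X ** X))) = Im (trace (hadj X ** X))" by simp
  then show "Im (trace (hadj X ** X)) = Im (complex_of_real ((norm X)\<^sup>2))" by simp
  show "Re (trace (hadj X ** X)) = Re (complex_of_real ((norm X)\<^sup>2))"
    unfolding inner_eq_trace[symmetric] by (simp add: power2_norm_eq_inner)
qed

lemma norm_hadj [simp]: "norm (hadj X) = norm X"
proof -
  have "trace (hadj (hadj X) ** hadj X) = trace (hadj X ** X)"
    unfolding hadj_hadj by (rule trace_mul_sym)
  then have "complex_of_real ((norm (hadj X))\<^sup>2) = complex_of_real ((norm X)\<^sup>2)"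
    unfolding trace_hadj_self .
  then have "(norm (hadj X))\<^sup>2 = (norm X)\<^sup>2" by (simp only: of_real_eq_iff)
  then show ?thesis by simp
qed

lemma linear_hadj: "linear (hadj :: 'n::finite cmat \<Rightarrow> 'n cmat)"
  by (rule linearI) (auto simp: hadj_add hadj_scaleR)

lemma linear_sandwich:
  fixes A B :: "'n::finite cmat"
  shows "linear (\<lambda>X. A ** X ** B)"
  by (rule linearI) (auto simp: matrix_distrib scaleR_mult)

lemma matrix_vec_lincomb:
  "A *v (u + c *s w) = A *v u + c *s (A *v (w :: complex ^ 'n::finite))"
  by (simp add: matrix_vector_right_distrib vector_scalar_commute)

lemma quadratic_form_eq_0:
  assumes "\<And>v. hinner v (A *v v) = 0"
  shows "A = (0 :: 'n::finite cmat)"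
proof -
  have pol: "hinner v (A *v w) = 0" for v w
  proof -
    have *: "c * hinner v (A *v w) + cnj c * hinner w (A *v v) = 0" for c
      using assms[of "v + c *s w"] assms[of v] assms[of w]
      by (simp add: matrix_vec_lincomb algebra_simps vector_scalar_commute)
    from *[of 1] *[of \<i>] show ?thesis by (simp add: complex_eq_iff)
  qed
  have "A *v w = 0" for w
    using pol[of "axis _ 1" w] by (simp add: hinner_axis vec_eq_iff)
  then show ?thesis by (simp add: matrix_eq)
qed

lemma quadratic_form_eqI:
  assumes "\<And>v. hinner v (A *v v) = hinner v (B *v v)"
  shows "A = (B :: 'n::finite cmat)"
  using quadratic_form_eq_0[of "A - B"] assms by (simp add: matrix_vector_mult_diff_rdistrib)

text \<open>The first-order condition at a minimum, for quadratic polynomials; every variational argument below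
  ends here.\<close>

lemma linear_part_le_0:
  fixes a p :: real
  assumes "\<And>t. t > 0 \<Longrightarrow> 0 \<le> t\<^sup>2 * p - t * a"
  shows "a \<le> 0"
proof (rule ccontr)
  assume "\<not> a \<le> 0"
  then have a: "a > 0" by simp
  define t where "t = a / (2 * (\<bar>p\<bar> + 1))"
  have t: "t > 0" using a by (simp add: t_def add_nonneg_pos)
  have "t * (t * p - a) \<ge> 0" using assms[OF t] by (simp add: power2_eq_square algebra_simps)
  then have "t * p \<ge> a" using t by (simp add: zero_le_mult_iff)
  moreover have "t * p \<le> t * (\<bar>p\<bar> + 1)" using t by (intro mult_left_mono) auto
  moreover have "t * (\<bar>p\<bar> + 1) = a / 2" by (simp add: t_def field_simps)
  ultimately show False using a by linarith
qed

lemma linear_part_eq_0: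
  fixes z :: complex and p :: real
  assumes "\<And>c. 0 \<le> Re (c * z) + (cmod c)\<^sup>2 * p"
  shows "z = 0"
proof -
  have "(cmod z)\<^sup>2 \<le> 0"
  proof (rule linear_part_le_0[where p = "(cmod z)\<^sup>2 * p"])
    fix t :: real assume "t > 0"
    have "Re (of_real (-t) * cnj z * z) = - t * (cmod z)\<^sup>2"
      unfolding cmod_power2 by (simp add: power2_eq_square algebra_simps)
    then show "0 \<le> t\<^sup>2 * ((cmod z)\<^sup>2 * p) - t * (cmod z)\<^sup>2"
      using assms[of "of_real (-t) * cnj z"]
      by (simp only: norm_mult power_mult_distrib complex_mod_cnj norm_of_real) (simp add: mult.assoc)
  qed
  then show ?thesis by simp
qed

section \<open>Positive semidefinite matrices\<close>

lemma psd_iff: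
  "psd A \<longleftrightarrow> hadj A = A \<and> (\<forall>v. 0 \<le> Re (hinner v (A *v v)))"
proof safe
  assume "psd A"
  then have r: "Im (hinner v (A *v v)) = 0" "0 \<le> Re (hinner v (A *v v))" for v
    by (auto simp: psd_def complex_nonneg_Reals_iff)
  show "0 \<le> Re (hinner v (A *v v))" for v by (rule r)
  show "hadj A = A"
  proof (rule quadratic_form_eqI)
    fix v
    have "hinner v (hadj A *v v) = cnj (hinner v (A *v v))"
      by (simp add: hinner_adj[of v "hadj A" v] cnj_hinner)
    also have "\<dots> = hinner v (A *v v)" using r by (simp add: complex_eq_iff)
    finally show "hinner v (hadj A *v v) = hinner v (A *v v)" .
  qed
next
  assume h: "hadj A = A" and p: "\<forall>v. 0 \<le> Re (hinner v (A *v v))"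
  have "Im (hinner v (A *v v)) = 0" for v
  proof -
    have "cnj (hinner v (A *v v)) = hinner v (A *v v)"
      by (metis cnj_hinner h hinner_adj)
    then show ?thesis by (simp add: complex_eq_iff)
  qed
  then show "psd A" using p by (simp add: psd_def complex_nonneg_Reals_iff)
qed

lemma psd_hadj: "psd A \<Longrightarrow> hadj A = A" and psd_Re: "psd A \<Longrightarrow> 0 \<le> Re (hinner v (A *v v))"
  by (auto simp: psd_iff)

lemma psd_hadj_mult_self: "psd (hadj B ** B)"
  unfolding psd_def
proof
  fix v
  have "hinner v ((hadj B ** B) *v v) = hinner (B *v v) (B *v v)"
    by (simp add: matrix_vector_mul_assoc[symmetric] hinner_adj[of v "hadj B"])
  then show "hinner v ((hadj B ** B) *v v) \<in> \<real>\<^sub>\<ge>\<^sub>0"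
    by (simp add: hinner_self del: of_real_power)
qed

lemma psd_congruence: "psd A \<Longrightarrow> psd (hadj B ** A ** B)"
  unfolding psd_def
proof
  fix v assume A: "\<forall>v. hinner v (A *v v) \<in> \<real>\<^sub>\<ge>\<^sub>0"
  have "hinner v ((hadj B ** A ** B) *v v) = hinner (B *v v) (A *v (B *v v))"
    by (simp add: matrix_vector_mul_assoc[symmetric] hinner_adj[of v "hadj B"])
  then show "hinner v ((hadj B ** A ** B) *v v) \<in> \<real>\<^sub>\<ge>\<^sub>0" using A by simp
qed

lemma psd_kernel:
  assumes "psd A" "Re (hinner v (A *v v)) = 0"
  shows "A *v v = 0"
proof -
  define w where "w = A *v v"
  have h: "hinner v (A *v w) = hinner w w" "hinner w (A *v v) = hinner w w"
    using psd_hadj[OF assms(1)] by (auto simp: w_def hinner_adj[of v A])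
  have "2 * (norm w)\<^sup>2 \<le> 0"
  proof (rule linear_part_le_0[where p = "Re (hinner w (A *v w))"])
    fix t :: real assume "t > 0"
    have "0 \<le> Re (hinner (v + of_real (-t) *s w) (A *v (v + of_real (-t) *s w)))"
      using assms(1) by (rule psd_Re)
    also have "\<dots> = Re (hinner v (A *v v)) - t * Re (hinner v (A *v w)) - t * Re (hinner w (A *v v))
        + t * (t * Re (hinner w (A *v w)))"
      by (simp only: matrix_vec_lincomb hinner_add hinner_scale) (simp add: algebra_simps)
    also have "\<dots> = t\<^sup>2 * Re (hinner w (A *v w)) - t * (2 * (norm w)\<^sup>2)"
      using assms(2) by (simp add: h hinner_self power2_eq_square algebra_simps del: of_real_power)
    finally show "0 \<le> \<dots>" .
  qed
  then show ?thesis by (simp add: w_def)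
qed

lemma trace_eq_sum_hinner: "trace A = (\<Sum>i\<in>UNIV. hinner (axis i 1) (A *v axis i 1))"
  unfolding trace_def hinner_axis
  by (simp add: matrix_vector_mult_def axis_def if_distrib[of "\<lambda>x. _ * x"] cong: if_cong)

lemma psd_trace: "psd A \<Longrightarrow> 0 \<le> Re (trace A)"
  by (simp add: trace_eq_sum_hinner sum_nonneg psd_Re)

lemma psd_trace_eq_0:
  assumes "psd A" "Re (trace A) = 0"
  shows "A = 0"
proof -
  have "(\<Sum>i\<in>UNIV. Re (hinner (axis i 1) (A *v axis i 1))) = 0"
    using assms(2) by (simp add: trace_eq_sum_hinner)
  then have "\<forall>i\<in>UNIV. Re (hinner (axis i 1) (A *v axis i 1)) = 0"
    using assms(1) by (subst (asm) sum_nonneg_eq_0_iff) (auto simp: psd_Re)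
  then have ax: "A *v axis i 1 = 0" for i using psd_kernel[OF assms(1)] by blast
  have "(A *v axis j 1) $ i = A $ i $ j" for i j
    by (simp add: matrix_vector_mult_def axis_def if_distrib[of "\<lambda>x. _ * x"] cong: if_cong)
  then show ?thesis using ax by (simp add: vec_eq_iff)
qed

section \<open>Symmetric operators on a subspace of a Euclidean space\<close>

text \<open>The maps of the theorem are constrained only on a subspace; an extension to the whole space makes
  boundedness and differentiation along paths available.\<close>

lemma linear_on_subspace_extend:
  fixes f :: "'a::euclidean_space \<Rightarrow> 'b::real_vector"
  assumes M: "subspace M"
    and add: "\<And>x y. x \<in> M \<Longrightarrow> y \<in> M \<Longrightarrow> f (x + y) = f x + f y"
    and scale: "\<And>c x. x \<in> M \<Longrightarrow> f (c *\<^sub>R x) = c *\<^sub>R f x"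
  obtains F where "linear F" "\<And>x. x \<in> M \<Longrightarrow> F x = f x"
proof -
  obtain B where B: "B \<subseteq> M" "independent B" "M \<subseteq> span B" using basis_exists[of M] by metis
  obtain F where F: "linear F" "\<forall>x\<in>B. F x = f x"
    using linear_independent_extend[OF B(2)] by metis
  have "x \<in> M \<and> F x = f x" if "x \<in> span B" for x
    using that
  proof (induction rule: span_induct_alt)
    case base
    have "f (0 *\<^sub>R 0) = 0 *\<^sub>R f 0" by (rule scale) (simp add: subspace_0 M)
    then show ?case by (simp add: subspace_0 M linear_0[OF F(1)])
  next
    case (step c x y)
    have x: "x \<in> M" using step B by auto
    have "F (c *\<^sub>R x + y) = c *\<^sub>R f x + f y"
      using step F by (simp add: linear_add[OF F(1)] linear_scale[OF F(1)])
    then show ?case using step x by (simp add: add scale subspace_add subspace_scale M)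
  qed
  then show ?thesis using that F(1) B(3) by blast
qed

lemma riesz_on_subspace:
  fixes f :: "'a::euclidean_space \<Rightarrow> real"
  assumes "subspace W" "linear f"
  obtains z where "z \<in> W" "\<And>w. w \<in> W \<Longrightarrow> f w = inner w z"
proof -
  obtain y z where yz: "y \<in> span W" "\<And>w. w \<in> span W \<Longrightarrow> orthogonal z w" "adjoint f 1 = y + z"
    using orthogonal_subspace_decomp_exists[of W "adjoint f 1"] by metis
  show thesis
  proof (rule that[of y])
    show "y \<in> W" using yz assms by (simp add: span_eq_iff[THEN iffD2])
    fix w assume "w \<in> W"
    have "f w = inner w (adjoint f 1)" using adjoint_works[OF assms(2), of w 1] by simp
    also have "\<dots> = inner w y"
      using yz(2)[OF span_base[OF \<open>w \<in> W\<close>]]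
      by (simp add: yz(3) inner_add_right orthogonal_def inner_commute)
    finally show "f w = inner w y" .
  qed
qed

text \<open>The orthogonal complement of the range of a symmetric operator is its kernel.\<close>

lemma symmetric_kernel_plus_range:
  fixes S :: "'a::euclidean_space \<Rightarrow> 'a"
  assumes W: "subspace W" and S: "linear S" "\<And>x. x \<in> W \<Longrightarrow> S x \<in> W"
    and sym: "\<And>x y. x \<in> W \<Longrightarrow> y \<in> W \<Longrightarrow> inner (S x) y = inner x (S y)"
    and y: "y \<in> W"
  obtains z v where "z \<in> W" "v \<in> W" "S z = 0" "y = z + S v"
proof -
  have sp: "span (S ` W) = S ` W"
    using linear_subspace_image[OF S(1) W] by (simp add: span_eq_iff)
  obtain r z where rz: "r \<in> S ` W" "\<And>w. w \<in> S ` W \<Longrightarrow> orthogonal z w" "y = r + z"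
    using orthogonal_subspace_decomp_exists[of "S ` W" y] unfolding sp by metis
  obtain v where v: "v \<in> W" "r = S v" using rz by auto
  have z: "z \<in> W" using subspace_diff[OF W y S(2)[OF v(1)]] rz(3) v(2) by simp
  have "inner (S z) (S z) = inner z (S (S z))" by (rule sym) (auto simp: z S)
  also have "\<dots> = 0" using rz(2)[of "S (S z)"] z S(2) by (auto simp: orthogonal_def)
  finally have "S z = 0" by simp
  then show thesis using that[of z v] z v rz by (simp add: add.commute)
qed

lemma homogeneous_min_on_sphere:
  fixes q :: "'a::euclidean_space \<Rightarrow> real"
  assumes W: "subspace W" and x: "x \<in> W" "x \<noteq> 0"
    and cont: "continuous_on UNIV q" and hom: "\<And>c x. q (c *\<^sub>R x) = c\<^sup>2 * q x"
  obtains v where "v \<in> W" "norm v = 1" "\<And>w. w \<in> W \<Longrightarrow> q v * (norm w)\<^sup>2 \<le> q w"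
proof -
  have c: "compact (sphere 0 1 \<inter> W)" by (intro compact_Int_closed closed_subspace W compact_sphere)
  have ne: "sphere 0 1 \<inter> W \<noteq> {}"
  proof -
    have "inverse (norm x) *\<^sub>R x \<in> sphere 0 1 \<inter> W" using x W by (simp add: subspace_scale)
    then show ?thesis by blast
  qed
  obtain v where v: "v \<in> sphere 0 1 \<inter> W" "\<And>w. w \<in> sphere 0 1 \<inter> W \<Longrightarrow> q v \<le> q w"
    using continuous_attains_inf[OF c ne continuous_on_subset[OF cont]] by blast
  show thesis
  proof (rule that[of v])
    fix w assume w: "w \<in> W"
    show "q v * (norm w)\<^sup>2 \<le> q w"
    proof (cases "w = 0")
      case True
      then show ?thesis using hom[of 0 w] by simp
    next
      case False
      have "q v \<le> q (inverse (norm w) *\<^sub>R w)"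
        by (rule v(2)) (use False w W in \<open>auto simp: subspace_scale\<close>)
      then show ?thesis using False by (simp add: hom field_simps)
    qed
  qed (use v in auto)
qed

text \<open>The maximum of the Rayleigh quotient of a symmetric operator is one of its eigenvalues.\<close>

lemma symmetric_nonpos_if_eigenvalues_nonpos:
  fixes S :: "'a::euclidean_space \<Rightarrow> 'a"
  assumes W: "subspace W" and S: "linear S" "\<And>x. x \<in> W \<Longrightarrow> S x \<in> W"
    and sym: "\<And>x y. x \<in> W \<Longrightarrow> y \<in> W \<Longrightarrow> inner (S x) y = inner x (S y)"
    and eig: "\<And>x l. x \<in> W \<Longrightarrow> x \<noteq> 0 \<Longrightarrow> S x = l *\<^sub>R x \<Longrightarrow> l \<le> 0"
    and x: "x \<in> W"
  shows "inner x (S x) \<le> 0"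
proof (cases "x = 0")
  case False
  define q where "q w = - inner w (S w)" for w
  have "continuous_on UNIV q" unfolding q_def
    by (intro continuous_intros linear_continuous_on linear_conv_bounded_linear[THEN iffD1] S)
  moreover have "q (c *\<^sub>R w) = c\<^sup>2 * q w" for c w
    by (simp add: q_def linear_scale[OF S(1)] power2_eq_square)
  ultimately obtain v where v: "v \<in> W" "norm v = 1" "\<And>w. w \<in> W \<Longrightarrow> q v * (norm w)\<^sup>2 \<le> q w"
    using homogeneous_min_on_sphere[OF W x False] by metis
  define u where "u = S v + q v *\<^sub>R v"
  have u: "u \<in> W" using v S W by (simp add: u_def subspace_add subspace_scale)
  have "2 * (norm u)\<^sup>2 \<le> 0"
  proof (rule linear_part_le_0[where p = "q u - q v * (norm u)\<^sup>2"])
    fix t :: real assume "t > 0"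
    have "q v * (norm (v + t *\<^sub>R u))\<^sup>2 \<le> q (v + t *\<^sub>R u)"
      using v u W by (simp add: subspace_add subspace_scale)
    moreover have "inner v (S u) = inner u (S v)" using sym[OF v(1) u] by (simp add: inner_commute)
    moreover have "q (v + t *\<^sub>R u) = q v - t * inner v (S u) - t * inner u (S v) + t\<^sup>2 * q u"
      by (simp add: q_def linear_add[OF S(1)] linear_scale[OF S(1)] inner_add_left inner_add_right
          power2_eq_square algebra_simps)
    moreover have "(norm (v + t *\<^sub>R u))\<^sup>2 = 1 + 2 * t * inner u v + t\<^sup>2 * (norm u)\<^sup>2"
      using v(2) unfolding power2_norm_eq_inner
      by (simp add: inner_add_left inner_add_right norm_eq_1 inner_commute power2_eq_square algebra_simps)
    moreover have "(norm u)\<^sup>2 = inner u (S v) + q v * inner u v"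
      unfolding power2_norm_eq_inner by (subst (2) u_def) (simp add: inner_add_right)
    ultimately have "0 \<le> t\<^sup>2 * q u - t\<^sup>2 * (q v * (norm u)\<^sup>2) - 2 * t * (inner u (S v) + q v * inner u v)"
      by (simp add: algebra_simps)
    then show "0 \<le> t\<^sup>2 * (q u - q v * (norm u)\<^sup>2) - t * (2 * (norm u)\<^sup>2)"
      using \<open>(norm u)\<^sup>2 = inner u (S v) + q v * inner u v\<close> by (simp add: algebra_simps)
  qed
  then have "S v = (- q v) *\<^sub>R v" by (simp add: u_def eq_neg_iff_add_eq_0)
  moreover have "v \<noteq> 0" using v(2) by auto
  ultimately have "- q v \<le> 0" using v(1) eig by blast
  then have "0 \<le> q v * (norm x)\<^sup>2" by simp
  also have "\<dots> \<le> q x" using v x by blast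
  finally show ?thesis by (simp add: q_def)
qed simp

section \<open>The square root of a positive definite matrix\<close>

lemma continuous_quadratic_form: "continuous_on UNIV (\<lambda>v. Re (hinner v (A *v v)))"
  unfolding Re_hinner
  by (intro continuous_intros linear_continuous_on linear_conv_bounded_linear[THEN iffD1]
      matrix_vector_mul_linear)

lemma matrix_vec_scaleR: "A *v (c *\<^sub>R v) = c *\<^sub>R (A *v (v :: complex ^ 'n::finite))"
  by (rule linear_scale[OF matrix_vector_mul_linear])

lemma quadratic_form_min:
  obtains v where "norm v = 1"
    "\<And>w. Re (hinner v (A *v v)) * (norm w)\<^sup>2 \<le> Re (hinner w (A *v w))"
proof (rule homogeneous_min_on_sphere[of UNIV "axis undefined 1" "\<lambda>v. Re (hinner v (A *v v))"])
  show "Re (hinner (c *\<^sub>R v) (A *v (c *\<^sub>R v))) = c\<^sup>2 * Re (hinner v (A *v v))" for c v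
    unfolding matrix_vec_scaleR Re_hinner by (simp add: power2_eq_square)
qed (use that in \<open>auto simp: axis_eq_0_iff continuous_quadratic_form\<close>)

lemma norm_sq_columns: "(norm (X :: 'n::finite cmat))\<^sup>2 = (\<Sum>j\<in>UNIV. (norm (column j X))\<^sup>2)"
proof -
  have "(\<Sum>j\<in>UNIV. (norm (column j X))\<^sup>2) = (\<Sum>i\<in>UNIV. \<Sum>j\<in>UNIV. inner (X $ i $ j) (X $ i $ j))"
    unfolding power2_norm_eq_inner by (subst sum.swap) (simp add: inner_vec_def column_def)
  also have "\<dots> = (norm X)\<^sup>2" unfolding power2_norm_eq_inner by (simp add: inner_vec_def)
  finally show ?thesis by simp
qed

lemma norm_mult_le_opnorm:
  fixes S X :: "'n::finite cmat"
  assumes "0 \<le> r" "\<And>v. norm (S *v v) \<le> r * norm v"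
  shows "norm (S ** X) \<le> r * norm X"
proof -
  have "column j (S ** X) = S *v column j X" for j
    by (simp add: vec_eq_iff column_def matrix_matrix_mult_def matrix_vector_mult_def)
  then have "(norm (S ** X))\<^sup>2 = (\<Sum>j\<in>UNIV. (norm (S *v column j X))\<^sup>2)"
    by (simp add: norm_sq_columns)
  also have "\<dots> \<le> (\<Sum>j\<in>UNIV. (r * norm (column j X))\<^sup>2)"
    by (intro sum_mono power_mono assms) auto
  also have "\<dots> = (r * norm X)\<^sup>2"
    by (simp add: power_mult_distrib norm_sq_columns sum_distrib_left)
  finally show ?thesis using assms(1) by (simp add: power2_le_iff_abs_le)
qed

text \<open>If \<open>B\<close> is Hermitian with operator norm at most \<open>q < 1\<close>, then \<open>S = (B + S\<^sup>2) / 2\<close> has a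
  Hermitian solution by contraction, and \<open>(1 - S)\<^sup>2 = 1 - B\<close>. The ball of radius
  \<open>r = 1 - sqrt (1 - q)\<close> is mapped into itself because \<open>(q + r\<^sup>2) / 2 = r\<close>.\<close>

lemma sqrt_one_minus_contraction:
  fixes B :: "'n::finite cmat"
  assumes B: "hadj B = B" "\<And>v. norm (B *v v) \<le> q * norm v" and q: "0 \<le> q" "q < 1"
  obtains R where "psd R" "R ** R = mat 1 - B"
proof -
  define r where "r = 1 - sqrt (1 - q)"
  have r: "0 \<le> r" "r < 1" "(q + r\<^sup>2) / 2 = r"
    using q by (auto simp: r_def power2_eq_square field_simps)
  define K where "K = {S :: 'n cmat. hadj S = S \<and> (\<forall>v. norm (S *v v) \<le> r * norm v)}"
  define f where "f S = (1/2) *\<^sub>R (B + S ** S)" for S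
  have "closed K"
  proof -
    have "K = {S. hadj S = S} \<inter> (\<Inter>v. {S. norm (S *v v) \<le> r * norm v})" by (auto simp: K_def)
    moreover have "closed {S :: 'n cmat. hadj S = S}"
      by (intro closed_Collect_eq continuous_intros linear_continuous_on
          linear_conv_bounded_linear[THEN iffD1] linear_hadj)
    moreover have "closed {S :: 'n cmat. norm (S *v v) \<le> r * norm v}" for v
    proof (intro closed_Collect_le continuous_intros linear_continuous_on
          linear_conv_bounded_linear[THEN iffD1])
      show "linear (\<lambda>S :: 'n cmat. S *v v)"
        by (rule linearI) (auto simp: matrix_vector_mult_add_rdistrib scaleR_vec)
    qed
    ultimately show ?thesis by (simp only:) (auto intro!: closed_Int closed_INT)
  qed
  then have "complete K" by (simp add: complete_eq_closed)
  moreover have "0 \<in> K" using r by (simp add: K_def)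
  moreover have "f ` K \<subseteq> K"
  proof
    fix T assume "T \<in> f ` K"
    then obtain S where S: "hadj S = S" "\<And>v. norm (S *v v) \<le> r * norm v" "T = f S"
      by (auto simp: K_def)
    have "norm (f S *v v) \<le> r * norm v" for v
    proof -
      have "norm (f S *v v) \<le> (1/2) * (norm (B *v v) + norm (S *v (S *v v)))"
        unfolding f_def scaleR_vec
        by (simp add: matrix_vector_mult_add_rdistrib matrix_vector_mul_assoc[symmetric] norm_triangle_ineq)
      also have "\<dots> \<le> (1/2) * (q * norm v + r * (r * norm v))"
      proof -
        have "norm (S *v (S *v v)) \<le> r * norm (S *v v)" by (rule S)
        also have "\<dots> \<le> r * (r * norm v)" by (intro mult_left_mono S r)
        finally show ?thesis using B(2)[of v] by simp
      qed
      also have "\<dots> = ((q + r\<^sup>2) / 2) * norm v" by (simp add: power2_eq_square algebra_simps)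
      finally show ?thesis by (simp only: r)
    qed
    then show "T \<in> K" using S B by (simp add: K_def f_def hadj_scaleR hadj_add hadj_mult)
  qed
  moreover have "dist (f S) (f T) \<le> r * dist S T" if ST: "S \<in> K" "T \<in> K" for S T
  proof -
    have h: "hadj S = S" "hadj T = T" "\<And>v. norm (S *v v) \<le> r * norm v" "\<And>v. norm (T *v v) \<le> r * norm v"
      using ST by (auto simp: K_def)
    have 1: "norm (S ** (S - T)) \<le> r * norm (S - T)" by (rule norm_mult_le_opnorm[OF r(1) h(3)])
    have "norm ((S - T) ** T) = norm (hadj ((S - T) ** T))" by simp
    also have "\<dots> = norm (T ** (S - T))" by (simp only: hadj_mult hadj_diff h)
    also have "\<dots> \<le> r * norm (S - T)" by (rule norm_mult_le_opnorm[OF r(1) h(4)])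
    finally have 2: "norm ((S - T) ** T) \<le> r * norm (S - T)" .
    have "f S - f T = (1/2) *\<^sub>R (S ** (S - T) + (S - T) ** T)"
      by (simp add: f_def matrix_distrib scaleR_diff_right[symmetric])
    then have "norm (f S - f T) \<le> (1/2) * (norm (S ** (S - T)) + norm ((S - T) ** T))"
      by (simp add: norm_triangle_ineq)
    then show ?thesis using 1 2 by (simp add: dist_norm)
  qed
  ultimately obtain S where S: "S \<in> K" "f S = S"
    using Banach_fix[of K r f] r by blast
  define R where "R = mat 1 - S"
  have fx: "S + S = B + S ** S"
  proof -
    have "S + S = 2 *\<^sub>R f S" using S(2) by (simp add: scaleR_2)
    then show ?thesis by (simp add: f_def)
  qed
  have "R ** R = mat 1 - (S + S) + S ** S" by (simp add: R_def matrix_distrib)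
  also have "\<dots> = mat 1 - B" unfolding fx by simp
  finally have sq: "R ** R = mat 1 - B" .
  have "psd R" unfolding psd_iff
  proof (intro conjI allI)
    show "hadj R = R" using S(1) by (simp add: R_def K_def hadj_diff)
    fix v
    have "inner v (S *v v) \<le> norm v * norm (S *v v)" by (rule norm_cauchy_schwarz)
    also have "\<dots> \<le> norm v * (r * norm v)" using S(1) by (intro mult_left_mono) (auto simp: K_def)
    also have "\<dots> \<le> norm v * (1 * norm v)" using r by (intro mult_left_mono mult_right_mono) auto
    also have "\<dots> = inner v v" by (simp add: power2_norm_eq_inner[symmetric] power2_eq_square)
    finally show "0 \<le> Re (hinner v (R *v v))"
      by (simp add: R_def Re_hinner matrix_vector_mult_diff_rdistrib inner_diff_right)
  qed
  then show thesis using that sq by blast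
qed

text \<open>The contraction argument applies to \<open>1 - A / c\<close>, whose operator norm is below 1 for large \<open>c\<close>
  because the form of \<open>A\<close> is bounded away from 0 on the unit sphere.\<close>

lemma psd_sqrt_exists:
  fixes A :: "'n::finite cmat"
  assumes A: "psd A" and inj: "\<And>v. A *v v = 0 \<Longrightarrow> v = 0"
  obtains R where "psd R" "R ** R = A"
proof -
  obtain v where v: "norm v = 1" "\<And>w. Re (hinner v (A *v v)) * (norm w)\<^sup>2 \<le> Re (hinner w (A *v w))"
    using quadratic_form_min by blast
  define d where "d = Re (hinner v (A *v v))"
  have "d \<noteq> 0" using psd_kernel[OF A] inj v(1) by (force simp: d_def)
  then have d: "d > 0" using psd_Re[OF A, of v] by (simp add: d_def)
  obtain k where k: "k > 0" "\<And>w. norm (A *v w) \<le> k * norm w"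
    using linear_bounded_pos[OF matrix_vector_mul_linear[of A]] by blast
  have "d \<le> k"
  proof -
    have "d \<le> norm v * norm (A *v v)" unfolding d_def Re_hinner by (rule norm_cauchy_schwarz)
    then show ?thesis using v(1) k(2)[of v] by simp
  qed
  define c where "c = k\<^sup>2 / d"
  define q where "q = sqrt (1 - d\<^sup>2 / k\<^sup>2)"
  have c: "c > 0" using d k by (simp add: c_def)
  have "d\<^sup>2 \<le> k\<^sup>2" using \<open>d \<le> k\<close> d by simp
  then have q: "0 \<le> q" "q < 1" "q\<^sup>2 = 1 - d\<^sup>2 / k\<^sup>2" using d k by (auto simp: q_def)
  define B where "B = mat 1 - (1 / c) *\<^sub>R A"
  \<comment> \<open>\<open>c\<close> minimises the bound \<open>1 - 2 d / c + k\<^sup>2 / c\<^sup>2\<close> on the squared operator norm of \<open>B\<close>\<close>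
  have "norm (B *v w) \<le> q * norm w" for w
  proof -
    have "(norm (B *v w))\<^sup>2 = (norm w)\<^sup>2 - 2 / c * inner w (A *v w) + (1 / c)\<^sup>2 * (norm (A *v w))\<^sup>2"
      unfolding power2_norm_eq_inner B_def
      by (simp add: matrix_vector_mult_diff_rdistrib scaleR_vec inner_diff_left inner_diff_right
          inner_commute power2_eq_square algebra_simps)
    also have "\<dots> \<le> (norm w)\<^sup>2 - 2 / c * (d * (norm w)\<^sup>2) + (1 / c)\<^sup>2 * (k * norm w)\<^sup>2"
      using v(2)[of w] c k by (intro add_mono diff_mono mult_left_mono power_mono)
        (auto simp: d_def Re_hinner)
    also have "\<dots> = (1 - d\<^sup>2 / k\<^sup>2) * (norm w)\<^sup>2"
      using d k by (simp add: c_def power2_eq_square field_simps)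
    also have "\<dots> = (q * norm w)\<^sup>2" by (simp add: q power_mult_distrib)
    finally show ?thesis using q by (simp add: power2_le_iff_abs_le)
  qed
  moreover have "hadj B = B" using psd_hadj[OF A] by (simp add: B_def hadj_diff hadj_scaleR)
  ultimately obtain R where R: "psd R" "R ** R = mat 1 - B"
    using sqrt_one_minus_contraction q by blast
  show thesis
  proof (rule that[of "sqrt c *\<^sub>R R"])
    show "psd (sqrt c *\<^sub>R R)"
      using R(1) c by (simp add: psd_iff hadj_scaleR scaleR_vec Re_hinner)
    show "(sqrt c *\<^sub>R R) ** (sqrt c *\<^sub>R R) = A"
      using c by (simp add: scaleR_mult R B_def)
  qed
qed

text \<open>With \<open>D = R - T\<close> the hypothesis says \<open>R D + D T = 0\<close>, so the positive matrices \<open>D R D\<close> and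
  \<open>D T D\<close> have traces that cancel; hence both vanish, and so does \<open>D\<^sup>3 = D R D - D T D\<close>.\<close>

lemma psd_sqrt_unique:
  assumes R: "psd R" and T: "psd T" and eq: "R ** R = T ** (T :: 'n::finite cmat)"
  shows "R = T"
proof -
  define D where "D = R - T"
  have D: "hadj D = D" using R T by (simp add: D_def hadj_diff psd_hadj)
  have "R ** D + D ** T = 0" by (simp add: D_def matrix_distrib eq)
  then have "D ** (R ** D + D ** T) = 0" by simp
  then have "D ** R ** D + D ** (D ** T) = 0" by (simp add: matrix_add_ldistrib matrix_mul_assoc)
  moreover have "trace (D ** (D ** T)) = trace (D ** T ** D)" by (rule trace_mul_sym)
  ultimately have "trace (D ** R ** D) + trace (D ** T ** D) = 0"
    by (metis trace_add trace_zero)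
  then have tr: "Re (trace (D ** R ** D)) + Re (trace (D ** T ** D)) = 0"
    by (metis plus_complex.simps(1) zero_complex.simps(1))
  have p: "psd (D ** R ** D)" "psd (D ** T ** D)"
    using psd_congruence[OF R, of D] psd_congruence[OF T, of D] by (simp_all add: D)
  have "D ** R ** D = 0" "D ** T ** D = 0"
    using psd_trace[OF p(1)] psd_trace[OF p(2)] tr psd_trace_eq_0[OF p(1)] psd_trace_eq_0[OF p(2)]
    by linarith+
  then have "D ** D ** D = 0" by (simp add: D_def matrix_distrib)
  then have "trace (hadj (D ** D) ** (D ** D)) = 0"
    by (simp add: hadj_mult D matrix_mul_assoc)
  then have "D ** D = 0" by (simp add: trace_hadj_self)
  then have "trace (hadj D ** D) = 0" by (simp add: D)
  then have "D = 0" by (simp add: trace_hadj_self)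
  then show ?thesis by (simp add: D_def)
qed

lemma psd_sqrt_works:
  fixes A :: "'n::finite cmat"
  assumes "psd A" "\<And>v. A *v v = 0 \<Longrightarrow> v = 0"
  shows "psd (psd_sqrt A)" "psd_sqrt A ** psd_sqrt A = A"
proof -
  have "\<exists>!R. psd R \<and> R ** R = A"
    using psd_sqrt_exists[OF assms] psd_sqrt_unique by metis
  from theI'[OF this] show "psd (psd_sqrt A)" "psd_sqrt A ** psd_sqrt A = A"
    by (auto simp: psd_sqrt_def)
qed

lemma full_rank_kernel:
  fixes A :: "'n::finite cmat"
  assumes "rank A = CARD('n)" "A *v v = 0"
  shows "v = 0"
proof -
  have "vec.span (rows A) = UNIV"
    using assms(1) vec.dim_eq_full[of "rows A"]
    by (simp add: row_rank_def_gen vec.dimension_def card_cart_basis)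
  then show ?thesis using assms(2) matrix_left_invertible_span_rows_gen matrix_left_invertible_ker by blast
qed

section \<open>The KMS inner product on a von Neumann algebra\<close>

lemma linear_mapD:
  assumes "linear_map M \<Phi>"
  shows "X \<in> M \<Longrightarrow> \<Phi> X \<in> M"
    and "X \<in> M \<Longrightarrow> Y \<in> M \<Longrightarrow> \<Phi> (X + Y) = \<Phi> X + \<Phi> Y"
    and "X \<in> M \<Longrightarrow> \<Phi> (cscale c X) = cscale c (\<Phi> X)"
    and "X \<in> M \<Longrightarrow> \<Phi> (r *\<^sub>R X) = r *\<^sub>R \<Phi> X"
    and "X \<in> M \<Longrightarrow> \<Phi> (- X) = - \<Phi> X"
  using assms by (auto simp: linear_map_def scaleR_eq_cscale uminus_eq_cscale)

lemma von_neumann_algebraD: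
  assumes "von_neumann_algebra M"
  shows "mat 1 \<in> M" "X \<in> M \<Longrightarrow> Y \<in> M \<Longrightarrow> X + Y \<in> M" "X \<in> M \<Longrightarrow> Y \<in> M \<Longrightarrow> X ** Y \<in> M"
    "X \<in> M \<Longrightarrow> hadj X \<in> M" "X \<in> M \<Longrightarrow> cscale c X \<in> M" "X \<in> M \<Longrightarrow> r *\<^sub>R X \<in> M"
    "X \<in> M \<Longrightarrow> - X \<in> M" "0 \<in> M" "X \<in> M \<Longrightarrow> Y \<in> M \<Longrightarrow> X - Y \<in> M"
proof -
  show cs: "X \<in> M \<Longrightarrow> cscale c X \<in> M" for X c
    using assms by (simp add: von_neumann_algebra_def)
  show "mat 1 \<in> M" and add: "X \<in> M \<Longrightarrow> Y \<in> M \<Longrightarrow> X + Y \<in> M"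
    and "X \<in> M \<Longrightarrow> Y \<in> M \<Longrightarrow> X ** Y \<in> M" "X \<in> M \<Longrightarrow> hadj X \<in> M" for X Y
    using assms by (simp_all add: von_neumann_algebra_def)
  show "X \<in> M \<Longrightarrow> r *\<^sub>R X \<in> M" and um: "X \<in> M \<Longrightarrow> - X \<in> M" for X r
    by (auto simp: scaleR_eq_cscale uminus_eq_cscale cs)
  show "0 \<in> M" using cs[OF \<open>mat 1 \<in> M\<close>, of 0] by simp
  show "X \<in> M \<Longrightarrow> Y \<in> M \<Longrightarrow> X - Y \<in> M" using add[of X "- Y"] um by simp
qed

lemma von_neumann_algebra_subspace: "von_neumann_algebra M \<Longrightarrow> subspace M"
  by (simp add: subspace_def von_neumann_algebraD)

lemma linear_map_diff:
  assumes "von_neumann_algebra M" "linear_map M \<Phi>" "X \<in> M" "Y \<in> M"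
  shows "\<Phi> (X - Y) = \<Phi> X - \<Phi> Y"
  using linear_mapD(2)[OF assms(2), of X "- Y"] assms
  by (simp add: linear_mapD(5) von_neumann_algebraD)

lemma linear_map_zero:
  assumes "von_neumann_algebra M" "linear_map M \<Phi>"
  shows "\<Phi> 0 = 0"
  using linear_map_diff[OF assms, of 0 0] von_neumann_algebraD(8)[OF assms(1)] by simp

lemma linear_map_extend:
  assumes "von_neumann_algebra M" "linear_map M \<Phi>"
  obtains F where "linear F" "\<And>X. X \<in> M \<Longrightarrow> F X = \<Phi> X"
  using linear_on_subspace_extend[OF von_neumann_algebra_subspace[OF assms(1)], of \<Phi>]
    linear_mapD[OF assms(2)] by metis

locale kms_algebra =
  fixes M :: "'n::finite cmat set" and \<sigma> :: "'n cmat"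
  assumes vN: "von_neumann_algebra M" and density: "\<sigma> \<in> full_rank_densities M"
begin

text \<open>Conjugation by \<open>\<sigma>\<^bsup>1/4\<^esup>\<close> is an isometry from the KMS to the Hilbert-Schmidt inner product, so the
  Euclidean facts above apply to the image of \<open>M\<close>.\<close>

definition root4 :: "'n cmat" where "root4 = psd_sqrt (psd_sqrt \<sigma>)"

definition J :: "'n cmat \<Rightarrow> 'n cmat" where "J X = root4 ** X ** root4"

lemmas M_closed = von_neumann_algebraD[OF vN]

lemma sqrt_density: "psd (psd_sqrt \<sigma>)" "psd_sqrt \<sigma> ** psd_sqrt \<sigma> = \<sigma>"
  and sqrt_density_kernel: "psd_sqrt \<sigma> *v v = 0 \<Longrightarrow> v = 0"
  and root4: "psd root4" "root4 ** root4 = psd_sqrt \<sigma>"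
  and root4_kernel: "root4 *v v = 0 \<Longrightarrow> v = 0"
proof -
  have \<sigma>: "psd \<sigma>" "\<And>v. \<sigma> *v v = 0 \<Longrightarrow> v = 0"
    using density full_rank_kernel[of \<sigma>] by (auto simp: full_rank_densities_def)
  show s: "psd (psd_sqrt \<sigma>)" "psd_sqrt \<sigma> ** psd_sqrt \<sigma> = \<sigma>"
    using psd_sqrt_works[OF \<sigma>] by auto
  show k: "psd_sqrt \<sigma> *v v = 0 \<Longrightarrow> v = 0" for v
    using \<sigma>(2) by (metis s(2) matrix_vector_mul_assoc matrix_vector_mult_0_right)
  show r: "psd root4" "root4 ** root4 = psd_sqrt \<sigma>"
    unfolding root4_def using psd_sqrt_works[OF s(1) k] by auto
  show "root4 *v v = 0 \<Longrightarrow> v = 0" for v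
    using k by (metis r(2) matrix_vector_mul_assoc matrix_vector_mult_0_right)
qed

lemma linear_J: "linear J"
  unfolding J_def[abs_def] by (rule linear_sandwich)

lemma J_inverse:
  obtains J' where "linear J'" "\<And>X. J' (J X) = X"
proof -
  obtain R where "R ** root4 = mat 1" "root4 ** R = mat 1"
    using root4_kernel matrix_left_invertible_ker[of root4] matrix_left_right_inverse by metis
  then have "R ** J X ** R = X" for X
    by (simp add: J_def matrix_mul_assoc) (simp add: matrix_mul_assoc[symmetric])
  then show thesis using that[of "\<lambda>X. R ** X ** R"] linear_sandwich by blast
qed

lemma J_eq_0_iff: "J X = 0 \<longleftrightarrow> X = 0"
proof -
  obtain J' where "linear J'" "\<And>X. J' (J X) = X" using J_inverse by blast
  then show ?thesis using linear_0[of J'] linear_0[OF linear_J] by metis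
qed

lemma kms_inner_eq: "kms_inner \<sigma> X Y = trace (hadj (J X) ** J Y)"
proof -
  have h: "hadj root4 = root4" by (rule psd_hadj[OF root4(1)])
  have "trace (hadj (J X) ** J Y) = trace ((root4 ** hadj X ** root4 ** root4 ** Y) ** root4)"
    by (simp add: J_def hadj_mult h matrix_mul_assoc)
  also have "\<dots> = trace (root4 ** (root4 ** hadj X ** root4 ** root4 ** Y))"
    by (rule trace_mul_sym)
  also have "\<dots> = trace ((root4 ** root4) ** hadj X ** (root4 ** root4) ** Y)"
    by (simp add: matrix_mul_assoc)
  finally show ?thesis by (simp add: kms_inner_def root4)
qed

lemma Re_kms_inner: "Re (kms_inner \<sigma> X Y) = inner (J X) (J Y)"
  by (simp add: kms_inner_eq inner_eq_trace)

lemma kms_norm_eq: "kms_norm \<sigma> X = norm (J X)"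
  by (simp add: kms_norm_def Re_kms_inner norm_eq_sqrt_inner)

lemma kms_inner_cscale:
  "kms_inner \<sigma> X (cscale c Y) = c * kms_inner \<sigma> X Y"
  "kms_inner \<sigma> (cscale c X) Y = cnj c * kms_inner \<sigma> X Y"
  by (simp_all add: kms_inner_def hadj_cscale cscale_mult trace_cscale)

lemma kms_inner_add:
  "kms_inner \<sigma> X (Y + Z) = kms_inner \<sigma> X Y + kms_inner \<sigma> X Z"
  "kms_inner \<sigma> (X + Y) Z = kms_inner \<sigma> X Z + kms_inner \<sigma> Y Z"
  by (simp_all add: kms_inner_def hadj_add matrix_distrib matrix_add_rdistrib trace_add)

lemma kms_inner_diff:
  "kms_inner \<sigma> X (Y - Z) = kms_inner \<sigma> X Y - kms_inner \<sigma> X Z"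
  "kms_inner \<sigma> (X - Y) Z = kms_inner \<sigma> X Z - kms_inner \<sigma> Y Z"
  by (simp_all add: kms_inner_def hadj_diff matrix_distrib trace_sub)

lemma kms_inner_one: "kms_inner \<sigma> (mat 1) X = trace (\<sigma> ** X)"
  by (simp add: kms_inner_def sqrt_density matrix_mul_assoc[symmetric])

lemma kms_inner_self_eq_0: "kms_inner \<sigma> X X = 0 \<Longrightarrow> X = 0"
  using Re_kms_inner[of X X] by (simp add: J_eq_0_iff)

text \<open>Replacing \<open>X\<close> by \<open>\<i> X\<close> recovers the imaginary part from the real part, so real orthogonality is
  enough to identify complex adjoints.\<close>

lemma kms_inner_cong_Re:
  assumes "\<And>X. X \<in> M \<Longrightarrow> Re (kms_inner \<sigma> (\<Phi> X) Y) = Re (kms_inner \<sigma> X Z)"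
    and \<Phi>: "linear_map M \<Phi>" and X: "X \<in> M"
  shows "kms_inner \<sigma> (\<Phi> X) Y = kms_inner \<sigma> X Z"
  using assms(1)[OF X] assms(1)[OF M_closed(5)[OF X, of \<i>]]
  by (simp add: linear_mapD[OF \<Phi>] X kms_inner_cscale complex_eq_iff)

lemma kms_adjoint_eqI:
  assumes Z: "Z \<in> M" "\<And>X. X \<in> M \<Longrightarrow> kms_inner \<sigma> (\<Phi> X) Y = kms_inner \<sigma> X Z"
  shows "kms_adjoint M \<sigma> \<Phi> Y = Z"
  unfolding kms_adjoint_def
proof (rule the_equality)
  fix Z' assume Z': "Z' \<in> M \<and> (\<forall>X\<in>M. kms_inner \<sigma> (\<Phi> X) Y = kms_inner \<sigma> X Z')"
  have "Z' - Z \<in> M" using Z(1) Z' by (simp add: M_closed(9))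
  then have "kms_inner \<sigma> (Z' - Z) Z' = kms_inner \<sigma> (Z' - Z) Z" using Z(2)[of "Z' - Z"] Z' by simp
  then have "kms_inner \<sigma> (Z' - Z) (Z' - Z) = 0" by (simp add: kms_inner_diff)
  then show "Z' = Z" using kms_inner_self_eq_0 by fastforce
qed (use Z in auto)

lemma kms_adjoint_works:
  assumes \<Phi>: "linear_map M \<Phi>" and X: "X \<in> M"
  shows "kms_inner \<sigma> (\<Phi> X) Y = kms_inner \<sigma> X (kms_adjoint M \<sigma> \<Phi> Y)"
proof -
  obtain F where F: "linear F" "\<And>X. X \<in> M \<Longrightarrow> F X = \<Phi> X" using linear_map_extend[OF vN \<Phi>] by blast
  obtain J' where J': "linear J'" "\<And>X. J' (J X) = X" using J_inverse by blast
  define f where "f w = inner (J (F (J' w))) (J Y)" for w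
  have "linear f" unfolding f_def
    by (rule linearI) (simp_all add: linear_add[OF linear_J] linear_scale[OF linear_J] inner_add_left
        linear_add[OF F(1)] linear_scale[OF F(1)] linear_add[OF J'(1)] linear_scale[OF J'(1)])
  moreover have "subspace (J ` M)"
    by (rule linear_subspace_image[OF linear_J von_neumann_algebra_subspace[OF vN]])
  ultimately obtain z where z: "z \<in> J ` M" "\<And>w. w \<in> J ` M \<Longrightarrow> f w = inner w z"
    using riesz_on_subspace by metis
  then obtain Z where Z: "Z \<in> M" "z = J Z" by auto
  have "Re (kms_inner \<sigma> (\<Phi> X) Y) = Re (kms_inner \<sigma> X Z)" if "X \<in> M" for X
    using z(2)[of "J X"] that by (simp add: Re_kms_inner f_def J' F Z)
  then have *: "kms_inner \<sigma> (\<Phi> X) Y = kms_inner \<sigma> X Z" if "X \<in> M" for X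
    using kms_inner_cong_Re[OF _ \<Phi> that] by blast
  have "kms_adjoint M \<sigma> \<Phi> Y = Z" by (rule kms_adjoint_eqI[OF Z(1) *])
  then show ?thesis using *[OF X] by simp
qed

text \<open>Transport of a KMS-symmetric map along the isometry \<open>J\<close>.\<close>

lemma kms_symmetric_transport:
  assumes S: "linear_map M S"
    and sym: "\<And>X Y. X \<in> M \<Longrightarrow> Y \<in> M \<Longrightarrow> kms_inner \<sigma> (S X) Y = kms_inner \<sigma> X (S Y)"
  obtains G where "linear G" "\<And>X. X \<in> M \<Longrightarrow> G (J X) = J (S X)"
    "\<And>x. x \<in> J ` M \<Longrightarrow> G x \<in> J ` M"
    "\<And>x y. x \<in> J ` M \<Longrightarrow> y \<in> J ` M \<Longrightarrow> inner (G x) y = inner x (G y)"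
proof -
  obtain F where F: "linear F" "\<And>X. X \<in> M \<Longrightarrow> F X = S X" using linear_map_extend[OF vN S] by blast
  obtain J' where J': "linear J'" "\<And>X. J' (J X) = X" using J_inverse by blast
  define G where "G = J \<circ> F \<circ> J'"
  have G: "G (J X) = J (S X)" if "X \<in> M" for X using that by (simp add: G_def J' F)
  have "inner (J (S X)) (J Y) = inner (J X) (J (S Y))" if "X \<in> M" "Y \<in> M" for X Y
    using sym[OF that] by (metis Re_kms_inner)
  then have "inner (G x) y = inner x (G y)" if "x \<in> J ` M" "y \<in> J ` M" for x y
    using that G by auto
  moreover have "G x \<in> J ` M" if "x \<in> J ` M" for x using that G linear_mapD(1)[OF S] by auto
  moreover have "linear G" unfolding G_def by (intro linear_compose linear_J F(1) J'(1))
  ultimately show thesis using that G by blast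
qed

lemma kms_symmetric_kernel_plus_range:
  assumes S: "linear_map M S"
    and sym: "\<And>X Y. X \<in> M \<Longrightarrow> Y \<in> M \<Longrightarrow> kms_inner \<sigma> (S X) Y = kms_inner \<sigma> X (S Y)"
    and Y: "Y \<in> M"
  obtains Z V where "Z \<in> M" "V \<in> M" "S Z = 0" "Y = Z + S V"
proof -
  obtain G where G: "linear G" "\<And>X. X \<in> M \<Longrightarrow> G (J X) = J (S X)" "\<And>x. x \<in> J ` M \<Longrightarrow> G x \<in> J ` M"
    "\<And>x y. x \<in> J ` M \<Longrightarrow> y \<in> J ` M \<Longrightarrow> inner (G x) y = inner x (G y)"
    using kms_symmetric_transport[OF S sym] by metis
  have W: "subspace (J ` M)"
    by (rule linear_subspace_image[OF linear_J von_neumann_algebra_subspace[OF vN]])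
  obtain z v where zv: "z \<in> J ` M" "v \<in> J ` M" "G z = 0" "J Y = z + G v"
    using symmetric_kernel_plus_range[OF W G(1) G(3) G(4), of "J Y"] Y by blast
  then obtain Z V where ZV: "Z \<in> M" "z = J Z" "V \<in> M" "v = J V" by auto
  have "S Z = 0" using zv(3) G(2) ZV J_eq_0_iff by simp
  moreover have "J (Y - (Z + S V)) = 0"
    using zv(4) G(2) ZV by (simp add: linear_diff[OF linear_J] linear_add[OF linear_J])
  then have "Y = Z + S V" by (simp add: J_eq_0_iff)
  ultimately show thesis using that ZV by blast
qed

lemma kms_symmetric_nonpos:
  assumes S: "linear_map M S"
    and sym: "\<And>X Y. X \<in> M \<Longrightarrow> Y \<in> M \<Longrightarrow> kms_inner \<sigma> (S X) Y = kms_inner \<sigma> X (S Y)"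
    and eig: "\<And>X l. X \<in> M \<Longrightarrow> X \<noteq> 0 \<Longrightarrow> S X = l *\<^sub>R X \<Longrightarrow> l \<le> 0"
    and X: "X \<in> M"
  shows "inner (J X) (J (S X)) \<le> 0"
proof -
  obtain G where G: "linear G" "\<And>X. X \<in> M \<Longrightarrow> G (J X) = J (S X)" "\<And>x. x \<in> J ` M \<Longrightarrow> G x \<in> J ` M"
    "\<And>x y. x \<in> J ` M \<Longrightarrow> y \<in> J ` M \<Longrightarrow> inner (G x) y = inner x (G y)"
    using kms_symmetric_transport[OF S sym] by metis
  have W: "subspace (J ` M)"
    by (rule linear_subspace_image[OF linear_J von_neumann_algebra_subspace[OF vN]])
  have "l \<le> 0" if "x \<in> J ` M" "x \<noteq> 0" "G x = l *\<^sub>R x" for x l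
  proof -
    obtain Y where Y: "Y \<in> M" "x = J Y" using \<open>x \<in> J ` M\<close> by auto
    have "J (S Y - l *\<^sub>R Y) = 0"
      using that(3) Y G(2) by (simp add: linear_diff[OF linear_J] linear_scale[OF linear_J])
    then have "S Y = l *\<^sub>R Y" by (simp add: J_eq_0_iff)
    moreover have "Y \<noteq> 0" using that(2) Y linear_0[OF linear_J] by auto
    ultimately show "l \<le> 0" using eig Y by blast
  qed
  then have "inner (J X) (G (J X)) \<le> 0"
    using symmetric_nonpos_if_eigenvalues_nonpos[OF W G(1) G(3) G(4)] X by blast
  then show ?thesis using G(2) X by simp
qed

end

section \<open>Generators of completely positive semigroups\<close>

text \<open>The series of the semigroup is \<open>X + t L X + O(t\<^sup>2)\<close>; the remainder is bounded on \<open>0 < t \<le> 1\<close> by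
  \<open>t\<^sup>2\<close> times a convergent exponential tail.\<close>

lemma semigroup_exp_derivative:
  assumes M: "von_neumann_algebra M" and L: "linear_map M L" and X: "X \<in> M"
  shows "((\<lambda>t. (1 / t) *\<^sub>R (semigroup_exp L t X - X)) \<longlongrightarrow> L X) (at_right 0)"
proof -
  obtain F where F: "linear F" "\<And>X. X \<in> M \<Longrightarrow> F X = L X" using linear_map_extend[OF M L] by blast
  obtain K where K: "K > 0" "\<And>X. norm (F X) \<le> K * norm X" using linear_bounded_pos[OF F(1)] by blast
  have pow: "(L ^^ k) X \<in> M \<and> norm ((L ^^ k) X) \<le> K ^ k * norm X" for k
  proof (induction k)
    case (Suc k)
    have "norm (L ((L ^^ k) X)) \<le> K * norm ((L ^^ k) X)" using K(2) F(2) Suc by metis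
    also have "\<dots> \<le> K * (K ^ k * norm X)" using Suc K(1) by (intro mult_left_mono) auto
    finally show ?case using Suc linear_mapD(1)[OF L] by (simp add: mult.assoc)
  qed (use X in auto)
  define b where "b k = K ^ k / fact k * norm X" for k
  have sb: "summable b"
    unfolding b_def using summable_mult2[OF summable_exp[of K], of "norm X"]
    by (simp add: divide_inverse mult.commute)
  then have sb2: "summable (\<lambda>k. b (k + 2))" by (rule summable_ignore_initial_segment)
  define C where "C = (\<Sum>k. b (k + 2))"
  have bound: "norm ((1 / t) *\<^sub>R (semigroup_exp L t X - X) - L X) \<le> t * C" if t: "0 < t" "t \<le> 1" for t
  proof -
    define a where "a k = (t ^ k / fact k) *\<^sub>R (L ^^ k) X" for k
    have na: "norm (a k) \<le> t ^ k * b k" for k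
    proof -
      have "norm (a k) = t ^ k / fact k * norm ((L ^^ k) X)" using t by (simp add: a_def)
      also have "\<dots> \<le> t ^ k / fact k * (K ^ k * norm X)" using pow t by (intro mult_left_mono) auto
      finally show ?thesis by (simp add: b_def)
    qed
    have b0: "b k \<ge> 0" for k using K by (simp add: b_def)
    have na2: "norm (a k) \<le> b k" for k
    proof -
      have "t ^ k * b k \<le> 1 * b k" using t b0 by (intro mult_right_mono power_le_one) auto
      then show ?thesis using na[of k] by simp
    qed
    have sa: "summable a" by (rule summable_comparison_test[OF _ sb]) (use na2 in auto)
    have na3: "norm (a (k + 2)) \<le> t\<^sup>2 * b (k + 2)" for k
    proof -
      have "t ^ (k + 2) = t ^ k * t\<^sup>2" by (rule power_add)
      also have "\<dots> \<le> 1 * t\<^sup>2" using t by (intro mult_right_mono power_le_one) auto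
      finally have "t ^ (k + 2) * b (k + 2) \<le> t\<^sup>2 * b (k + 2)" using b0 by (intro mult_right_mono) auto
      then show ?thesis using na[of "k + 2"] by linarith
    qed
    have "semigroup_exp L t X = (\<Sum>k. a (k + 2)) + (\<Sum>k<2. a k)"
      unfolding semigroup_exp_def a_def[symmetric] by (rule suminf_split_initial_segment[OF sa])
    also have "(\<Sum>k<2. a k) = X + t *\<^sub>R L X" by (simp add: a_def numeral_2_eq_2)
    finally have e: "semigroup_exp L t X - X = t *\<^sub>R L X + (\<Sum>k. a (k + 2))" by simp
    have "norm (\<Sum>k. a (k + 2)) \<le> (\<Sum>k. t\<^sup>2 * b (k + 2))"
      using na3 sb2 by (intro norm_suminf_le summable_mult) auto
    also have "\<dots> = t\<^sup>2 * C" unfolding C_def by (rule suminf_mult[OF sb2])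
    finally have n: "norm (\<Sum>k. a (k + 2)) \<le> t\<^sup>2 * C" .
    have "(1 / t) *\<^sub>R (semigroup_exp L t X - X) - L X = (1 / t) *\<^sub>R (\<Sum>k. a (k + 2))"
      using t by (simp add: e scaleR_add_right)
    then show ?thesis using n t by (simp add: field_simps power2_eq_square)
  qed
  have "((\<lambda>t. (1 / t) *\<^sub>R (semigroup_exp L t X - X) - L X) \<longlongrightarrow> 0) (at_right 0)"
  proof (rule Lim_null_comparison)
    have "eventually (\<lambda>t. 0 < t \<and> t < 1) (at_right (0::real))"
      by (simp add: eventually_at_right_field) (auto intro: exI[of _ 1])
    then show "\<forall>\<^sub>F t in at_right 0. norm ((1 / t) *\<^sub>R (semigroup_exp L t X - X) - L X) \<le> t * C"
      by eventually_elim (use bound in auto)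
    show "((\<lambda>t. t * C) \<longlongrightarrow> 0) (at_right 0)" by (auto intro!: tendsto_eq_intros)
  qed
  then show ?thesis by (simp add: Lim_null[symmetric])
qed

definition block_form :: "nat \<Rightarrow> (nat \<Rightarrow> complex ^ 'n) \<Rightarrow> (nat \<Rightarrow> nat \<Rightarrow> 'n::finite cmat) \<Rightarrow> complex" where
  "block_form m v X = (\<Sum>i<m. \<Sum>j<m. hinner (v i) (X i j *v v j))"

lemma block_psd_iff: "block_psd m X \<longleftrightarrow> (\<forall>v. block_form m v X \<in> \<real>\<^sub>\<ge>\<^sub>0)"
  by (simp add: block_psd_def block_form_def)

lemma block_form_add: "block_form m v (\<lambda>i j. X i j + Y i j) = block_form m v X + block_form m v Y"
  and block_form_diff: "block_form m v (\<lambda>i j. X i j - Y i j) = block_form m v X - block_form m v Y"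
  and block_form_scaleR: "block_form m v (\<lambda>i j. r *\<^sub>R X i j) = r *\<^sub>R block_form m v X"
proof -
  have s: "hinner u (r *\<^sub>R w) = of_real r * hinner u w" for u w :: "complex ^ 'a" and r
    by (simp add: hinner_def sum_distrib_left) (simp add: scaleR_conv_of_real mult_ac)
  have c: "r *\<^sub>R z = of_real r * z" for z :: complex and r by (rule scaleR_conv_of_real)
  show "block_form m v (\<lambda>i j. X i j + Y i j) = block_form m v X + block_form m v Y"
    "block_form m v (\<lambda>i j. X i j - Y i j) = block_form m v X - block_form m v Y"
    "block_form m v (\<lambda>i j. r *\<^sub>R X i j) = r *\<^sub>R block_form m v X"
    by (simp_all add: block_form_def matrix_vector_mult_add_rdistrib matrix_vector_mult_diff_rdistrib
        sum.distrib sum_subtractf scaleR_vec s sum_distrib_left c)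
qed

lemma tendsto_block_form:
  fixes X :: "'b \<Rightarrow> nat \<Rightarrow> nat \<Rightarrow> 'a::finite cmat"
  assumes "\<And>i j. i < m \<Longrightarrow> j < m \<Longrightarrow> ((\<lambda>t. X t i j) \<longlongrightarrow> Y i j) F"
  shows "((\<lambda>t. block_form m v (X t)) \<longlongrightarrow> block_form m v Y) F"
proof -
  have "linear (\<lambda>A. hinner u (A *v w))" for u w :: "complex ^ 'a"
  proof (rule linearI)
    fix r :: real and A :: "'a cmat"
    have "hinner u ((r *\<^sub>R A) *v w) = of_real r * hinner u (A *v w)"
      by (simp only: scaleR_eq_cscale cscale_vec hinner_scale)
    then show "hinner u ((r *\<^sub>R A) *v w) = r *\<^sub>R hinner u (A *v w)"
      by (simp only: scaleR_conv_of_real)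
  qed (simp add: matrix_vector_mult_add_rdistrib)
  then have bl: "bounded_linear (\<lambda>A. hinner u (A *v w))" for u w :: "complex ^ 'a"
    by (simp add: linear_conv_bounded_linear)
  show ?thesis unfolding block_form_def
  proof (intro tendsto_sum)
    fix i j assume "i \<in> {..<m}" "j \<in> {..<m}"
    then show "((\<lambda>t. hinner (v i) (X t i j *v v j)) \<longlongrightarrow> hinner (v i) (Y i j *v v j)) F"
      using bounded_linear.tendsto[OF bl assms] by simp
  qed
qed

text \<open>Infinitesimal form of complete positivity. The condition is linear in \<open>L\<close> for fixed data, so it
  passes from \<open>L\<^sub>A + \<gamma> L\<^sub>S\<close> to the leading coefficient \<open>L\<^sub>S\<close>.\<close>

definition conditionally_cp :: "'n::finite cmat set \<Rightarrow> ('n cmat \<Rightarrow> 'n cmat) \<Rightarrow> bool" where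
  "conditionally_cp M L \<longleftrightarrow>
     (\<forall>m X v. (\<forall>i<m. \<forall>j<m. X i j \<in> M) \<and> block_psd m X \<longrightarrow>
        Im (block_form m v (\<lambda>i j. L (X i j))) = 0 \<and>
        (block_form m v X = 0 \<longrightarrow> 0 \<le> Re (block_form m v (\<lambda>i j. L (X i j)))))"

lemma qms_generator_conditionally_cp:
  assumes M: "von_neumann_algebra M" and L: "qms_generator M L"
  shows "conditionally_cp M L"
  unfolding conditionally_cp_def
proof (intro allI impI, elim conjE)
  fix m X and v :: "nat \<Rightarrow> complex ^ 'a"
  assume X: "\<forall>i<m. \<forall>j<m. X i j \<in> M" and psd: "block_psd m X"
  have lin: "linear_map M L" using L by (simp add: qms_generator_def)
  define P where "P t i j = semigroup_exp L t (X i j)" for t i j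
  define D where "D t = (1 / t) *\<^sub>R (block_form m v (P t) - block_form m v X)" for t
  have X0: "Im (block_form m v X) = 0" "0 \<le> Re (block_form m v X)"
    using psd by (auto simp: block_psd_iff complex_nonneg_Reals_iff)
  have P0: "Im (block_form m v (P t)) = 0" "0 \<le> Re (block_form m v (P t))" if "t \<ge> 0" for t
  proof -
    have "block_psd m (P t)"
      using L that X psd unfolding qms_generator_def completely_positive_def P_def[abs_def] by blast
    then show "Im (block_form m v (P t)) = 0" "0 \<le> Re (block_form m v (P t))"
      by (auto simp: block_psd_iff complex_nonneg_Reals_iff)
  qed
  have "D = (\<lambda>t. block_form m v (\<lambda>i j. (1 / t) *\<^sub>R (P t i j - X i j)))"
    by (simp add: D_def fun_eq_iff block_form_diff block_form_scaleR)
  then have lim: "(D \<longlongrightarrow> block_form m v (\<lambda>i j. L (X i j))) (at_right 0)"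
    using X by (auto simp: P_def intro!: tendsto_block_form semigroup_exp_derivative[OF M lin])
  have pos: "eventually (\<lambda>t. 0 < t) (at_right (0::real))"
    by (rule eventually_at_right_less)
  show "Im (block_form m v (\<lambda>i j. L (X i j))) = 0 \<and>
    (block_form m v X = 0 \<longrightarrow> 0 \<le> Re (block_form m v (\<lambda>i j. L (X i j))))"
  proof (intro conjI impI)
    have "\<forall>\<^sub>F t in at_right 0. Im (D t) = 0"
      using pos by eventually_elim (simp add: D_def P0 X0)
    then have "((\<lambda>t. Im (D t)) \<longlongrightarrow> 0) (at_right 0)" by (rule tendsto_eventually)
    then show "Im (block_form m v (\<lambda>i j. L (X i j))) = 0"
      using tendsto_unique[OF _ tendsto_Im[OF lim]] by (simp add: trivial_limit_at_right_real)
    assume zero: "block_form m v X = 0"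
    have "\<forall>\<^sub>F t in at_right 0. 0 \<le> Re (D t)"
      using pos by eventually_elim (simp add: D_def P0 zero)
    then show "0 \<le> Re (block_form m v (\<lambda>i j. L (X i j)))"
      using tendsto_lowerbound[OF tendsto_Re[OF lim]] by (simp add: trivial_limit_at_right_real)
  qed
qed

lemma qms_generator_one:
  assumes M: "von_neumann_algebra M" and L: "qms_generator M L"
  shows "L (mat 1) = 0"
proof -
  have lin: "linear_map M L" using L by (simp add: qms_generator_def)
  have "\<forall>\<^sub>F t in at_right (0::real). (1 / t) *\<^sub>R (semigroup_exp L t (mat 1) - mat 1) = 0"
    using eventually_at_right_less[of "0::real"]
    by eventually_elim (use L in \<open>auto simp: qms_generator_def\<close>)
  then have "((\<lambda>t. (1 / t) *\<^sub>R (semigroup_exp L t (mat 1) - mat 1)) \<longlongrightarrow> 0) (at_right 0)"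
    by (rule tendsto_eventually)
  then show ?thesis
    using tendsto_unique[OF _ semigroup_exp_derivative[OF M lin]] von_neumann_algebraD(1)[OF M]
    by (simp add: trivial_limit_at_right_real)
qed

lemma nonneg_slope:
  fixes a b :: real
  assumes "\<And>\<gamma>. \<gamma> > 0 \<Longrightarrow> 0 \<le> a + \<gamma> * b"
  shows "0 \<le> b"
proof (rule ccontr)
  assume "\<not> 0 \<le> b"
  then have b: "b < 0" by simp
  define x where "x = \<bar>a\<bar> + 1"
  have "x / (- b) * b = - x" using b by simp
  moreover have "x / (- b) > 0" using b by (intro divide_pos_pos) (auto simp: x_def)
  ultimately show False using assms[of "x / (- b)"] abs_ge_self[of a] unfolding x_def by linarith
qed

text \<open>The tested quantity is affine in \<open>\<gamma>\<close>. It is real for two values of \<open>\<gamma>\<close>, and nonnegative for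
  arbitrarily large ones, so its slope has the same properties.\<close>

lemma conditionally_cp_leading_part:
  assumes "\<And>\<gamma>. \<gamma> > 0 \<Longrightarrow> conditionally_cp M (\<lambda>Y. A Y + \<gamma> *\<^sub>R S Y)"
  shows "conditionally_cp M S"
  unfolding conditionally_cp_def
proof (intro allI impI, elim conjE)
  fix m X and v :: "nat \<Rightarrow> complex ^ 'a"
  assume X: "\<forall>i<m. \<forall>j<m. X i j \<in> M" and psd: "block_psd m X"
  define a b where "a = block_form m v (\<lambda>i j. A (X i j))" and "b = block_form m v (\<lambda>i j. S (X i j))"
  have f: "block_form m v (\<lambda>i j. A (X i j) + \<gamma> *\<^sub>R S (X i j)) = a + \<gamma> *\<^sub>R b" for \<gamma>
    by (simp add: block_form_add block_form_scaleR a_def b_def)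
  have 1: "Im (a + \<gamma> *\<^sub>R b) = 0" if "\<gamma> > 0" for \<gamma>
    using assms[OF that] X psd unfolding conditionally_cp_def f[symmetric] by blast
  have 2: "0 \<le> Re a + \<gamma> * Re b" if "\<gamma> > 0" "block_form m v X = 0" for \<gamma>
  proof -
    have "0 \<le> Re (a + \<gamma> *\<^sub>R b)"
      using assms[OF that(1)] that(2) X psd unfolding conditionally_cp_def f[symmetric] by blast
    then show ?thesis by simp
  qed
  have "Im b = 0" using 1[of 1] 1[of 2] by simp
  moreover have "block_form m v X = 0 \<longrightarrow> 0 \<le> Re b" using nonneg_slope[of "Re a" "Re b"] 2 by blast
  ultimately show "Im (block_form m v (\<lambda>i j. S (X i j))) = 0 \<and>
    (block_form m v X = 0 \<longrightarrow> 0 \<le> Re (block_form m v (\<lambda>i j. S (X i j))))"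
    by (simp add: b_def)
qed

lemma block_form_1: "block_form (Suc 0) v X = hinner (v 0) (X 0 0 *v v 0)"
  by (simp add: block_form_def)

lemma block_form_2:
  "block_form 2 v X = hinner (v 0) (X 0 0 *v v 0) + hinner (v 0) (X 0 1 *v v 1)
     + hinner (v 1) (X 1 0 *v v 0) + hinner (v 1) (X 1 1 *v v 1)"
  by (simp add: block_form_def numeral_2_eq_2)

text \<open>The matrix \<open>(Y, 1)\<^sup>* (Y, 1)\<close> as a \<open>2 \<times> 2\<close> block.\<close>

definition schwarz_block :: "'n::finite cmat \<Rightarrow> nat \<Rightarrow> nat \<Rightarrow> 'n cmat" where
  "schwarz_block Y i j = (if i = 0 then if j = 0 then hadj Y ** Y else hadj Y else if j = 0 then Y else mat 1)"

lemma block_form_schwarz_block: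
  "block_form 2 v (schwarz_block Y) = complex_of_real ((norm (Y *v v 0 + v 1))\<^sup>2)"
proof -
  have "hinner (Y *v v 0 + v 1) (Y *v v 0 + v 1) = block_form 2 v (schwarz_block Y)"
    by (simp add: block_form_2 schwarz_block_def matrix_vector_mul_assoc[symmetric] hinner_adj[of _ "hadj Y"])
  then show ?thesis by (simp add: hinner_self)
qed

text \<open>The defect of the Leibniz rule for \<open>X\<^sup>* Y\<close>; it is sesquilinear when \<open>L\<close> preserves adjoints.\<close>

definition carre_du_champ :: "('n::finite cmat \<Rightarrow> 'n cmat) \<Rightarrow> 'n cmat \<Rightarrow> 'n cmat \<Rightarrow> 'n cmat" where
  "carre_du_champ L X Y = L (hadj X ** Y) - hadj X ** L Y - L (hadj X) ** Y"

locale conditionally_cp_map =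
  fixes M :: "'n::finite cmat set" and L :: "'n cmat \<Rightarrow> 'n cmat"
  assumes algebra: "von_neumann_algebra M" and linear: "linear_map M L"
    and cond_cp: "conditionally_cp M L" and unital: "L (mat 1) = 0"
begin

lemmas closed = von_neumann_algebraD[OF algebra]

text \<open>Infinitesimal Kadison-Schwarz inequality. The unit in the lower right corner of the block does not
  contribute because \<open>L 1 = 0\<close>, and the form of the block vanishes exactly for \<open>w = - Y u\<close>.\<close>

lemma schwarz:
  assumes Y: "Y \<in> M"
  defines "z \<equiv> \<lambda>u w. hinner u (L (hadj Y ** Y) *v u) + hinner u (L (hadj Y) *v w) + hinner w (L Y *v u)"
  shows "Im (z u w) = 0" "Y *v u + w = 0 \<Longrightarrow> 0 \<le> Re (z u w)"
proof -
  define v where "v i = (if i = 0 then u else w)" for i :: nat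
  have in_M: "\<forall>i<2. \<forall>j<2. schwarz_block Y i j \<in> M" using Y closed by (simp add: schwarz_block_def)
  have psd: "block_psd 2 (schwarz_block Y)"
    unfolding block_psd_iff block_form_schwarz_block by (simp del: of_real_power)
  have e: "block_form 2 v (\<lambda>i j. L (schwarz_block Y i j)) = z u w"
    by (simp add: block_form_2 schwarz_block_def v_def z_def unital)
  have f: "block_form 2 v (schwarz_block Y) = complex_of_real ((norm (Y *v u + w))\<^sup>2)"
    unfolding block_form_schwarz_block by (simp add: v_def)
  show "Im (z u w) = 0"
    using cond_cp in_M psd unfolding conditionally_cp_def e[symmetric] by blast
  assume "Y *v u + w = 0"
  then have "block_form 2 v (schwarz_block Y) = 0" by (simp add: f)
  then show "0 \<le> Re (z u w)"
    using cond_cp in_M psd unfolding conditionally_cp_def e[symmetric] by blast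
qed

text \<open>The mixed terms of the block form are real for all pairs of vectors, which forces them to be
  conjugate to each other.\<close>

lemma hadj_preserving:
  assumes Y: "Y \<in> M"
  shows "L (hadj Y) = hadj (L Y)"
proof -
  define p where "p u w = hinner u (L (hadj Y) *v w) + hinner w (L Y *v u)" for u w
  have im: "Im (p u w) = 0" for u w
    using schwarz(1)[OF Y, of u w] schwarz(1)[OF Y, of u 0] by (simp add: p_def)
  have "hinner v (L (hadj Y) *v v) = hinner v (hadj (L Y) *v v)" for v
  proof -
    have "hinner v (hadj (L Y) *v v) = cnj (hinner v (L Y *v v))"
      by (simp add: hinner_adj[of v "hadj (L Y)"] cnj_hinner)
    moreover have "p v (\<i> *s v) = \<i> * hinner v (L (hadj Y) *v v) - \<i> * hinner v (L Y *v v)"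
      by (simp add: p_def vector_scalar_commute)
    ultimately show ?thesis
      using im[of v v] im[of v "\<i> *s v"] by (simp add: p_def complex_eq_iff)
  qed
  then show ?thesis by (rule quadratic_form_eqI)
qed

lemma carre_du_champ_psd:
  assumes Y: "Y \<in> M"
  shows "psd (carre_du_champ L Y Y)"
  unfolding psd_def complex_nonneg_Reals_iff
proof (intro allI)
  fix u
  have "hinner u (carre_du_champ L Y Y *v u)
      = hinner u (L (hadj Y ** Y) *v u) + hinner u (L (hadj Y) *v (- (Y *v u)))
        + hinner (- (Y *v u)) (L Y *v u)"
    by (simp add: carre_du_champ_def matrix_vector_mult_diff_rdistrib matrix_vector_mul_assoc[symmetric]
        hinner_adj[of u "hadj Y"] linear_neg[OF matrix_vector_mul_linear])
  then show "0 \<le> Re (hinner u (carre_du_champ L Y Y *v u)) \<and> Im (hinner u (carre_du_champ L Y Y *v u)) = 0"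
    using schwarz[OF Y, of u "- (Y *v u)"] by simp
qed

lemma carre_du_champ_add_cscale:
  assumes X: "X \<in> M" and Y: "Y \<in> M"
  shows "carre_du_champ L (X + cscale c Y) (X + cscale c Y)
    = carre_du_champ L X X + cscale c (carre_du_champ L X Y) + cscale (cnj c) (carre_du_champ L Y X)
      + cscale (cnj c * c) (carre_du_champ L Y Y)"
  using X Y
  by (simp add: carre_du_champ_def hadj_add hadj_cscale matrix_distrib matrix_add_rdistrib cscale_mult
      linear_mapD[OF linear] closed cscale_cscale cscale_add cscale_diff mult.commute)

text \<open>Cauchy-Schwarz for the positive sesquilinear carre du champ: where it degenerates, \<open>L\<close> satisfies
  the Leibniz rule.\<close>

lemma leibniz_of_degenerate:
  assumes X: "X \<in> M" and Y: "Y \<in> M" and deg: "carre_du_champ L X X = 0"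
  shows "carre_du_champ L X Y = 0"
proof (rule quadratic_form_eq_0)
  fix u
  define z where "z = hinner u (carre_du_champ L X Y *v u) + cnj (hinner u (carre_du_champ L Y X *v u))"
  have adj: "carre_du_champ L Y X = hadj (carre_du_champ L X Y)"
    using X Y hadj_preserving[of X] hadj_preserving[of Y] hadj_preserving[of "hadj X ** Y"]
    by (simp add: carre_du_champ_def hadj_diff hadj_mult closed)
  have z: "z = 2 * hinner u (carre_du_champ L X Y *v u)"
    by (simp add: z_def adj hinner_adj[of u "hadj _"] cnj_hinner)
  have "z = 0"
  proof (rule linear_part_eq_0[where p = "Re (hinner u (carre_du_champ L Y Y *v u))"])
    fix c
    have "psd (carre_du_champ L (X + cscale c Y) (X + cscale c Y))"
      using X Y closed by (intro carre_du_champ_psd) auto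
    then have "0 \<le> Re (hinner u (carre_du_champ L (X + cscale c Y) (X + cscale c Y) *v u))"
      by (rule psd_Re)
    also have "\<dots> = Re (c * hinner u (carre_du_champ L X Y *v u))
        + Re (cnj (c * cnj (hinner u (carre_du_champ L Y X *v u))))
        + Re (cnj c * c * hinner u (carre_du_champ L Y Y *v u))"
      by (simp only: carre_du_champ_add_cscale[OF X Y] deg)
        (simp add: matrix_vector_mult_add_rdistrib cscale_vec)
    also have "cnj c * c = complex_of_real ((cmod c)\<^sup>2)"
      by (metis complex_norm_square mult.commute of_real_power)
    finally show "0 \<le> Re (c * z) + (cmod c)\<^sup>2 * Re (hinner u (carre_du_champ L Y Y *v u))"
      by (simp add: z_def distrib_left del: of_real_power)
  qed
  then show "hinner u (carre_du_champ L X Y *v u) = 0" using z by simp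
qed

text \<open>The case of a single block. For the generator of a positive semigroup it says that the form of the
  evolved \<open>W\<close> at \<open>v\<close>, which starts from 0 and stays nonnegative, has a nonnegative initial slope.\<close>

lemma minimum_principle:
  assumes W: "W \<in> M" "psd W" and v: "hinner v (W *v v) = 0"
  shows "0 \<le> Re (hinner v (L W *v v))"
proof -
  have "block_psd 1 (\<lambda>i j. W)" using W(2) by (simp add: block_psd_iff block_form_1 psd_def)
  then show ?thesis
    using cond_cp W(1) v
    unfolding conditionally_cp_def
    by (auto dest!: spec[of _ 1] spec[of _ "\<lambda>i j. W"] spec[of _ "\<lambda>i. v"] simp: block_form_1)
qed

end

section \<open>Fixed points, conditional expectation and pseudoinverse\<close>

locale kms_dissipator = kms_algebra M \<sigma> + conditionally_cp_map M L
  for M :: "'n::finite cmat set" and \<sigma> L +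
  assumes symmetric: "X \<in> M \<Longrightarrow> Y \<in> M \<Longrightarrow> kms_inner \<sigma> (L X) Y = kms_inner \<sigma> X (L Y)"
begin

abbreviation "N \<equiv> fixed_points M L"

lemma N_iff: "X \<in> N \<longleftrightarrow> X \<in> M \<and> L X = 0"
  by (simp add: fixed_points_def)

lemma trace_density_generator:
  assumes "X \<in> M"
  shows "trace (\<sigma> ** L X) = 0"
  using symmetric[OF closed(1) assms] by (simp add: unital kms_inner_one[symmetric]) (simp add: kms_inner_def)

lemma trace_density_psd:
  assumes P: "psd P"
  shows "0 \<le> Re (trace (\<sigma> ** P))" "Re (trace (\<sigma> ** P)) = 0 \<Longrightarrow> P = 0"
proof -
  define s where "s = psd_sqrt \<sigma>"
  have s: "hadj s = s" using psd_hadj sqrt_density(1) by (simp add: s_def)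
  have "\<sigma> ** P = s ** (s ** P)" using sqrt_density(2) by (simp add: s_def matrix_mul_assoc)
  then have tr: "trace (\<sigma> ** P) = trace (s ** P ** s)" by (simp add: trace_mul_sym[of s])
  have p: "psd (s ** P ** s)" using psd_congruence[OF P, of s] by (simp add: s)
  then show "0 \<le> Re (trace (\<sigma> ** P))" unfolding tr by (rule psd_trace)
  assume "Re (trace (\<sigma> ** P)) = 0"
  then have 0: "s ** P ** s = 0" using psd_trace_eq_0[OF p] tr by simp
  obtain R where R: "R ** s = mat 1" "s ** R = mat 1"
    using sqrt_density_kernel matrix_left_invertible_ker[of s] matrix_left_right_inverse[of s]
    unfolding s_def by metis
  have "P = (R ** s) ** P ** (s ** R)" by (simp add: R)
  also have "\<dots> = R ** (s ** P ** s) ** R" by (simp add: matrix_mul_assoc)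
  finally show "P = 0" by (simp add: 0)
qed

lemma N_hadj: "X \<in> N \<Longrightarrow> hadj X \<in> N"
  by (simp add: N_iff hadj_preserving closed)

text \<open>The invariant state makes the trace of the carre du champ vanish on a fixed point, so \<open>L\<close> is a
  bimodule map over its fixed points, which therefore form an algebra.\<close>

lemma generator_module_left:
  assumes A: "A \<in> N" and Y: "Y \<in> M"
  shows "L (A ** Y) = A ** L Y"
proof -
  define X where "X = hadj A"
  have X: "X \<in> M" "L X = 0" "L (hadj X) = 0" "hadj X = A"
    using A N_hadj[OF A] by (auto simp: X_def N_iff)
  have "carre_du_champ L X X = L (hadj X ** X)" using X by (simp add: carre_du_champ_def)
  then have "trace (\<sigma> ** carre_du_champ L X X) = 0"
    using trace_density_generator[of "hadj X ** X"] X(1) closed by simp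
  then have "carre_du_champ L X X = 0"
    using trace_density_psd(2)[OF carre_du_champ_psd[OF X(1)]] by simp
  then have "carre_du_champ L X Y = 0" by (rule leibniz_of_degenerate[OF X(1) Y])
  then show ?thesis using X by (simp add: carre_du_champ_def)
qed

lemma generator_module_right:
  assumes A: "A \<in> N" and Y: "Y \<in> M"
  shows "L (Y ** A) = L Y ** A"
proof -
  have "hadj (L (Y ** A)) = L (hadj A ** hadj Y)"
    using A Y hadj_preserving[of "Y ** A"] by (simp add: N_iff closed hadj_mult)
  also have "\<dots> = hadj A ** L (hadj Y)"
    using Y closed by (intro generator_module_left N_hadj A) auto
  also have "\<dots> = hadj (L Y ** A)" using Y by (simp add: hadj_preserving hadj_mult)
  finally show ?thesis by (metis hadj_hadj)
qed

lemma N_closed: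
  "mat 1 \<in> N" "A \<in> N \<Longrightarrow> B \<in> N \<Longrightarrow> A ** B \<in> N" "A \<in> N \<Longrightarrow> B \<in> N \<Longrightarrow> A + B \<in> N"
  "A \<in> N \<Longrightarrow> B \<in> N \<Longrightarrow> A - B \<in> N" "A \<in> N \<Longrightarrow> cscale c A \<in> N"
proof -
  show "mat 1 \<in> N" by (simp add: N_iff closed(1) unital)
  show "A ** B \<in> N" if A: "A \<in> N" and B: "B \<in> N"
  proof -
    have "L (A ** B) = A ** L B" using B by (intro generator_module_left A) (simp add: N_iff)
    then show ?thesis using A B by (simp add: N_iff closed(3))
  qed
  show "A + B \<in> N" if "A \<in> N" "B \<in> N"
    using that linear_mapD(2)[OF linear, of A B] by (simp add: N_iff closed(2))
  show "A - B \<in> N" if "A \<in> N" "B \<in> N"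
    using that linear_map_diff[OF algebra linear, of A B] by (simp add: N_iff closed(9))
  show "cscale c A \<in> N" if "A \<in> N"
    using that linear_mapD(3)[OF linear, of A c] by (simp add: N_iff closed(5))
qed

text \<open>An eigenvalue is tested with the non-commutative form \<open>tr (\<sigma> X\<^sup>* X)\<close>, for which the carre du champ
  gives dissipativity at once, and its sign does not depend on the inner product.\<close>

lemma eigenvalue_nonpos:
  assumes X: "X \<in> M" "X \<noteq> 0" "L X = l *\<^sub>R X"
  shows "l \<le> 0"
proof -
  have "L (hadj X) = l *\<^sub>R hadj X" using X by (simp add: hadj_preserving hadj_scaleR)
  then have "carre_du_champ L X X = L (hadj X ** X) - l *\<^sub>R (hadj X ** X) - l *\<^sub>R (hadj X ** X)"
    by (simp only: carre_du_champ_def X(3) scaleR_mult)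
  then have "trace (\<sigma> ** carre_du_champ L X X)
      = trace (\<sigma> ** L (hadj X ** X)) - l * trace (\<sigma> ** (hadj X ** X)) - l * trace (\<sigma> ** (hadj X ** X))"
    by (simp only: matrix_diff_distrib trace_sub scaleR_eq_cscale cscale_mult trace_cscale)
  moreover have "trace (\<sigma> ** L (hadj X ** X)) = 0"
    using X(1) by (intro trace_density_generator closed)
  ultimately have "Re (trace (\<sigma> ** carre_du_champ L X X)) = - (2 * l) * Re (trace (\<sigma> ** (hadj X ** X)))"
    by simp
  then have "0 \<le> - (2 * l) * Re (trace (\<sigma> ** (hadj X ** X)))"
    using trace_density_psd(1)[OF carre_du_champ_psd[OF X(1)]] by simp
  moreover have "Re (trace (\<sigma> ** (hadj X ** X))) > 0"
  proof -
    have "hadj X ** X \<noteq> 0" using trace_hadj_self[of X] X(2) by auto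
    then show ?thesis
      using trace_density_psd[OF psd_hadj_mult_self[of X]] by (simp add: less_le) auto
  qed
  ultimately show ?thesis by (simp add: mult_le_0_iff)
qed

lemma dissipative: "X \<in> M \<Longrightarrow> inner (J X) (J (L X)) \<le> 0"
  by (rule kms_symmetric_nonpos[OF linear symmetric eigenvalue_nonpos])

text \<open>The KMS-orthogonal projection onto the fixed points, along the range of \<open>L\<close>.\<close>

definition proj :: "'n cmat \<Rightarrow> 'n cmat" where
  "proj X = (SOME Z. Z \<in> N \<and> (\<exists>V\<in>M. X = Z + L V))"

lemma kms_N_range: "Z \<in> N \<Longrightarrow> V \<in> M \<Longrightarrow> kms_inner \<sigma> Z (L V) = 0"
  using symmetric[of Z V] by (simp add: N_iff) (simp add: kms_inner_def)

lemma kms_range_N: "Z \<in> N \<Longrightarrow> V \<in> M \<Longrightarrow> kms_inner \<sigma> (L V) Z = 0"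
  using symmetric[of V Z] by (simp add: N_iff) (simp add: kms_inner_def)

lemma proj_exists:
  assumes "X \<in> M"
  obtains V where "proj X \<in> N" "V \<in> M" "X = proj X + L V"
proof -
  have "\<exists>Z. Z \<in> N \<and> (\<exists>V\<in>M. X = Z + L V)"
    using kms_symmetric_kernel_plus_range[OF linear symmetric assms] N_iff by metis
  from someI_ex[OF this] show thesis using that by (auto simp: proj_def)
qed

lemma proj_eqI:
  assumes Z: "Z \<in> N" "V \<in> M" "X = Z + L V"
  shows "proj X = Z"
proof -
  have "X \<in> M" using Z linear_mapD(1)[OF linear] by (simp add: N_iff closed)
  then obtain V' where V': "proj X \<in> N" "V' \<in> M" "X = proj X + L V'" by (rule proj_exists)
  define D where "D = proj X - Z"
  have D: "D \<in> N" using V' Z by (simp add: D_def N_closed)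
  have "proj X + L V' = Z + L V" using V'(3) Z(3) by metis
  then have "D = L V - L V'" unfolding D_def by (metis add.commute add_diff_cancel_left' add_diff_eq diff_diff_eq2)
  also have "\<dots> = L (V - V')" using linear_map_diff[OF algebra linear Z(2) V'(2)] by simp
  finally have "D = L (V - V')" .
  then have "kms_inner \<sigma> D D = 0" using kms_N_range[OF D, of "V - V'"] Z V' by (simp add: closed)
  then have "D = 0" by (rule kms_inner_self_eq_0)
  then show ?thesis by (simp add: D_def)
qed

lemma proj_N: "X \<in> M \<Longrightarrow> proj X \<in> N"
  using proj_exists by blast

lemma proj_M: "X \<in> M \<Longrightarrow> proj X \<in> M"
  using proj_N by (simp add: N_iff)

lemma proj_fixed: "Z \<in> N \<Longrightarrow> proj Z = Z"
  using proj_eqI[of Z 0 Z] linear_map_zero[OF algebra linear] by (simp add: closed)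

lemma proj_range: "V \<in> M \<Longrightarrow> proj (L V) = 0"
  using proj_eqI[of 0 V "L V"] linear_map_zero[OF algebra linear] by (simp add: closed N_iff)

lemma proj_zero_range:
  assumes "X \<in> M" "proj X = 0"
  obtains V where "V \<in> M" "X = L V"
  using proj_exists[OF assms(1)] assms(2) by auto

lemma proj_linear: "linear_map M proj"
  unfolding linear_map_def
proof (intro conjI ballI allI)
  fix X Y c assume X: "X \<in> M" and Y: "Y \<in> M"
  obtain V where V: "proj X \<in> N" "V \<in> M" "X = proj X + L V" by (rule proj_exists[OF X])
  obtain W where W: "proj Y \<in> N" "W \<in> M" "Y = proj Y + L W" by (rule proj_exists[OF Y])
  show "proj (X + Y) = proj X + proj Y"
  proof (rule proj_eqI)
    show "X + Y = proj X + proj Y + L (V + W)"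
      using V W linear_mapD(2)[OF linear V(2) W(2)] by (simp add: algebra_simps)
  qed (use V W in \<open>auto simp: N_closed closed\<close>)
next
  fix X c assume X: "X \<in> M"
  obtain V where V: "proj X \<in> N" "V \<in> M" "X = proj X + L V" by (rule proj_exists[OF X])
  show "proj (cscale c X) = cscale c (proj X)"
  proof (rule proj_eqI)
    show "cscale c X = cscale c (proj X) + L (cscale c V)"
      using V(3) linear_mapD(3)[OF linear V(2)] by (metis cscale_add)
  qed (use V in \<open>auto simp: N_closed closed\<close>)
qed (rule proj_M)

lemma proj_symmetric:
  assumes "X \<in> M" "Y \<in> M"
  shows "kms_inner \<sigma> (proj X) Y = kms_inner \<sigma> X (proj Y)"
proof -
  obtain V where V: "proj X \<in> N" "V \<in> M" "X = proj X + L V" by (rule proj_exists[OF assms(1)])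
  obtain W where W: "proj Y \<in> N" "W \<in> M" "Y = proj Y + L W" by (rule proj_exists[OF assms(2)])
  have "kms_inner \<sigma> (proj X) Y = kms_inner \<sigma> (proj X) (proj Y)"
    by (subst W(3)) (simp add: kms_inner_add kms_N_range[OF V(1) W(2)])
  also have "\<dots> = kms_inner \<sigma> X (proj Y)"
    by (subst (2) V(3)) (simp add: kms_inner_add kms_range_N[OF W(1) V(2)])
  finally show ?thesis .
qed

text \<open>Write \<open>X = Z + L V\<close> with \<open>Z\<close> the projection of \<open>X\<close>. At a minimising unit vector \<open>v\<close> of the quadratic
  form of \<open>Z - \<delta> V\<close> the minimum principle gives \<open>\<langle>v, (X - Z) v\<rangle> \<le> 0\<close>, so \<open>\<langle>v, Z v\<rangle> \<ge> 0\<close>. Hence the form of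
  \<open>Z - \<delta> V\<close> is bounded below by \<open>O(\<delta>)\<close>, and \<open>\<delta> \<rightarrow> 0\<close>.\<close>

lemma proj_psd:
  assumes X: "X \<in> M" "psd X"
  shows "psd (proj X)"
proof -
  define Z where "Z = proj X"
  obtain V0 where V0: "Z \<in> N" "V0 \<in> M" "X = Z + L V0"
    using proj_exists[OF X(1)] unfolding Z_def by blast
  have hX: "hadj X = X" by (rule psd_hadj[OF X(2)])
  have eq: "X = hadj Z + L (hadj V0)"
    using V0 hX hadj_preserving[OF V0(2)] by (metis hadj_add)
  have hZ: "hadj Z = Z"
    using proj_eqI[OF N_hadj[OF V0(1)] _ eq] V0(2) closed by (simp add: Z_def)
  \<comment> \<open>the Hermitian part of \<open>V0\<close>, so that \<open>Z - \<delta> V\<close> minus its minimal form value is positive\<close>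
  define V where "V = (1/2) *\<^sub>R (V0 + hadj V0)"
  have V: "V \<in> M" "hadj V = V" using V0(2) closed by (auto simp: V_def hadj_scaleR hadj_add add.commute)
  have LV: "L V = X - Z"
  proof -
    have "L V = (1/2) *\<^sub>R (L V0 + L (hadj V0))"
      using V0(2) closed by (simp add: V_def linear_mapD[OF linear])
    also have "L V0 = X - Z" using V0(3) by (simp add: algebra_simps)
    also have "L (hadj V0) = X - Z" using eq hZ by (simp add: algebra_simps)
    finally show ?thesis by (simp add: scaleR_2[symmetric])
  qed
  obtain k where k: "k > 0" "\<And>w. norm (V *v w) \<le> k * norm w"
    using linear_bounded_pos[OF matrix_vector_mul_linear[of V]] by blast
  have Vk: "\<bar>Re (hinner w (V *v w))\<bar> \<le> k * (norm w)\<^sup>2" for w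
  proof -
    have "\<bar>Re (hinner w (V *v w))\<bar> \<le> norm w * norm (V *v w)"
      unfolding Re_hinner by (rule Cauchy_Schwarz_ineq2)
    also have "\<dots> \<le> norm w * (k * norm w)" by (intro mult_left_mono k) auto
    finally show ?thesis by (simp add: power2_eq_square mult_ac)
  qed
  have lower: "- (2 * d * k) * (norm w)\<^sup>2 \<le> Re (hinner w (Z *v w))" if d: "d > 0" for d w
  proof -
    define U where "U = Z - d *\<^sub>R V"
    have U: "U \<in> M" "hadj U = U"
      using V0(1) V hZ by (auto simp: U_def N_iff closed hadj_diff hadj_scaleR)
    have form: "Re (hinner u (U *v u)) = Re (hinner u (Z *v u)) - d * Re (hinner u (V *v u))" for u
      by (simp add: U_def matrix_vector_mult_diff_rdistrib scaleR_vec Re_hinner inner_diff_right)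
    obtain v where v: "norm v = 1" "\<And>w. Re (hinner v (U *v v)) * (norm w)\<^sup>2 \<le> Re (hinner w (U *v w))"
      using quadratic_form_min by blast
    define m where "m = Re (hinner v (U *v v))"
    define W where "W = U - m *\<^sub>R mat 1"
    have Wform: "Re (hinner u (W *v u)) = Re (hinner u (U *v u)) - m * (norm u)\<^sup>2" for u
      unfolding power2_norm_eq_inner
      by (simp add: W_def matrix_vector_mult_diff_rdistrib scaleR_vec Re_hinner inner_diff_right)
    have "psd W"
      unfolding psd_iff Wform using U v(2) by (auto simp: W_def hadj_diff hadj_scaleR m_def)
    moreover have "hinner v (W *v v) = 0"
      using \<open>psd W\<close> Wform[of v] v(1)
      by (auto simp: psd_def complex_nonneg_Reals_iff complex_eq_iff m_def)
    moreover have "W \<in> M" using U by (simp add: W_def closed)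
    ultimately have "0 \<le> Re (hinner v (L W *v v))" by (intro minimum_principle)
    also have "L W = - (d *\<^sub>R (X - Z))"
      using U(1) V V0(1) LV linear_map_diff[OF algebra linear]
      by (simp add: W_def U_def N_iff closed linear_mapD(4)[OF linear] unital)
    finally have "0 \<le> - (d * (Re (hinner v (X *v v)) - Re (hinner v (Z *v v))))"
      by (simp add: uminus_vec scaleR_vec matrix_vector_mult_diff_rdistrib Re_hinner inner_diff_right
          algebra_simps)
    then have "Re (hinner v (X *v v)) \<le> Re (hinner v (Z *v v))"
      using d by (simp add: zero_le_mult_iff mult_le_0_iff)
    then have "0 \<le> Re (hinner v (Z *v v))" using psd_Re[OF X(2), of v] by linarith
    moreover have "d * Re (hinner v (V *v v)) \<le> d * k"
      using Vk[of v] v(1) d by (intro mult_left_mono) auto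
    ultimately have "- (d * k) \<le> m" by (simp add: m_def form)
    then have "- (d * k) * (norm w)\<^sup>2 \<le> m * (norm w)\<^sup>2" by (intro mult_right_mono) auto
    also have "\<dots> \<le> Re (hinner w (U *v w))" using v(2) by (simp add: m_def)
    finally have "- (d * k) * (norm w)\<^sup>2 + d * Re (hinner w (V *v w)) \<le> Re (hinner w (Z *v w))"
      by (simp add: form)
    moreover have "d * (- (k * (norm w)\<^sup>2)) \<le> d * Re (hinner w (V *v w))"
      using Vk[of w] d by (intro mult_left_mono) auto
    ultimately show ?thesis by (simp add: algebra_simps)
  qed
  have "0 \<le> Re (hinner w (Z *v w))" for w
  proof (rule ccontr)
    assume neg: "\<not> ?thesis"
    define c where "c = 2 * k * (norm w)\<^sup>2 + 1"
    define d where "d = - Re (hinner w (Z *v w)) / c"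
    have c: "c > 0" using k(1) by (simp add: c_def add_nonneg_pos)
    then have d: "d > 0" using neg by (simp add: d_def divide_neg_pos)
    have "- (2 * d * k) * (norm w)\<^sup>2 = d - d * c" by (simp add: c_def algebra_simps)
    also have "d * c = - Re (hinner w (Z *v w))" using c by (simp add: d_def)
    finally show False using lower[OF d, of w] d by simp
  qed
  then show ?thesis using hZ by (simp add: psd_iff Z_def)
qed

lemma proj_is_cond_exp: "is_cond_exp M \<sigma> N proj"
  unfolding is_cond_exp_def
proof (intro conjI ballI impI)
  show "linear_map M proj" by (rule proj_linear)
  show "proj X \<in> N" if "X \<in> M" for X using that by (rule proj_N)
  show "psd (proj X)" if "X \<in> M" "psd X" for X using that by (rule proj_psd)
  show "proj (mat 1) = mat 1" by (intro proj_fixed N_closed)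
  fix A B X assume A: "A \<in> N" and B: "B \<in> N" and X: "X \<in> M"
  obtain V where V: "proj X \<in> N" "V \<in> M" "X = proj X + L V" by (rule proj_exists[OF X])
  show "proj (A ** X ** B) = A ** proj X ** B"
  proof (rule proj_eqI)
    have "L (A ** V ** B) = A ** L V ** B"
      using A V(2) by (simp add: generator_module_right[OF B] generator_module_left[OF A] N_iff closed)
    then show "A ** X ** B = A ** proj X ** B + L (A ** V ** B)"
      by (subst V(3)) (simp add: matrix_add_ldistrib matrix_add_rdistrib)
    show "A ** V ** B \<in> M" using A B V(2) by (simp add: N_iff closed)
  qed (use A B V in \<open>auto intro: N_closed\<close>)
next
  fix X assume X: "X \<in> M"
  obtain V where V: "proj X \<in> N" "V \<in> M" "X = proj X + L V" by (rule proj_exists[OF X])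
  show "trace (\<sigma> ** proj X) = trace (\<sigma> ** X)"
    by (subst (2) V(3)) (simp add: matrix_add_ldistrib trace_add trace_density_generator[OF V(2)])
qed

text \<open>A conditional expectation \<open>E\<close> is determined by \<open>tr (\<sigma> A E(X)) = tr (\<sigma> A X)\<close> for fixed points \<open>A\<close>.\<close>

lemma cond_exp_eq_proj:
  assumes X: "X \<in> M"
  shows "cond_exp M \<sigma> N X = proj X"
proof -
  define E where "E = cond_exp M \<sigma> N"
  have E: "is_cond_exp M \<sigma> N E"
    unfolding E_def cond_exp_def using someI[of "is_cond_exp M \<sigma> N", OF proj_is_cond_exp] .
  define D where "D = E X - proj X"
  have "D \<in> N" using E proj_N[OF X] X N_closed(4) by (auto simp: D_def is_cond_exp_def)
  then have A: "hadj D \<in> N" by (rule N_hadj)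
  then have AX: "hadj D ** X \<in> M" using X by (simp add: N_iff closed)
  have *: "trace (\<sigma> ** (hadj D ** F X)) = trace (\<sigma> ** (hadj D ** X))" if "is_cond_exp M \<sigma> N F" for F
  proof -
    have "F (hadj D ** X ** mat 1) = hadj D ** F X ** mat 1"
      using that A X N_closed(1) unfolding is_cond_exp_def by blast
    moreover have "trace (\<sigma> ** F (hadj D ** X)) = trace (\<sigma> ** (hadj D ** X))"
      using that AX unfolding is_cond_exp_def by blast
    ultimately show ?thesis by simp
  qed
  have "trace (\<sigma> ** (hadj D ** D)) = 0"
    using *[OF E] *[OF proj_is_cond_exp] by (simp add: D_def matrix_diff_distrib trace_sub)
  then have "hadj D ** D = 0" using trace_density_psd(2)[OF psd_hadj_mult_self] by simp
  then have "D = 0" using trace_hadj_self[of D] by simp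
  then show ?thesis by (simp add: D_def E_def)
qed

text \<open>The inverse of \<open>- L\<close> on the orthogonal complement of the fixed points, and zero on them. Both of its
  products with \<open>- L\<close> are the projection onto that complement, so the Penrose equations hold.\<close>

definition reduced_resolvent :: "'n cmat \<Rightarrow> 'n cmat" where
  "reduced_resolvent X = (THE V. V \<in> M \<and> proj V = 0 \<and> - L V = X - proj X)"

lemma reduced_resolvent_eqI:
  assumes V: "V \<in> M" "proj V = 0" "- L V = X - proj X"
  shows "reduced_resolvent X = V"
  unfolding reduced_resolvent_def
proof (rule the_equality)
  fix V' assume V': "V' \<in> M \<and> proj V' = 0 \<and> - L V' = X - proj X"
  have "L (V' - V) = 0"
    using V V' linear_map_diff[OF algebra linear] by (metis minus_equation_iff right_minus_eq)
  then have "V' - V \<in> N" using V V' by (simp add: N_iff closed)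
  then have "V' - V = proj (V' - V)" by (simp add: proj_fixed)
  also have "\<dots> = 0" using V V' by (simp add: linear_map_diff[OF algebra proj_linear])
  finally show "V' = V" by simp
qed (use V in auto)

lemma reduced_resolvent_works:
  assumes X: "X \<in> M"
  shows "reduced_resolvent X \<in> M" "proj (reduced_resolvent X) = 0"
    "- L (reduced_resolvent X) = X - proj X"
proof -
  obtain W where W: "proj X \<in> N" "W \<in> M" "X = proj X + L W" by (rule proj_exists[OF X])
  define V where "V = proj W - W"
  have V: "V \<in> M" "proj V = 0" "- L V = X - proj X"
  proof -
    show "V \<in> M" using W(2) by (simp add: V_def closed proj_M)
    show "proj V = 0"
      using W(2) proj_N by (simp add: V_def linear_map_diff[OF algebra proj_linear] proj_M proj_fixed)
    have "L V = - L W"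
      using W(2) proj_N[OF W(2)] by (simp add: V_def linear_map_diff[OF algebra linear] proj_M N_iff)
    then show "- L V = X - proj X" using W(3) by (simp add: algebra_simps)
  qed
  then have "reduced_resolvent X = V" by (rule reduced_resolvent_eqI)
  then show "reduced_resolvent X \<in> M" "proj (reduced_resolvent X) = 0"
    "- L (reduced_resolvent X) = X - proj X"
    using V by auto
qed

lemma reduced_resolvent_is_pseudoinverse:
  "is_pseudoinverse M \<sigma> (\<lambda>Y. - L Y) reduced_resolvent"
proof -
  note T = reduced_resolvent_works
  have lin: "linear_map M reduced_resolvent"
    unfolding linear_map_def
  proof (intro conjI ballI allI)
    fix X Y assume X: "X \<in> M" and Y: "Y \<in> M"
    show "reduced_resolvent (X + Y) = reduced_resolvent X + reduced_resolvent Y"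
      using T[OF X] T[OF Y] X Y
      by (intro reduced_resolvent_eqI)
        (auto simp: closed linear_mapD[OF linear] linear_mapD[OF proj_linear] algebra_simps)
  next
    fix X c assume X: "X \<in> M"
    show "reduced_resolvent (cscale c X) = cscale c (reduced_resolvent X)"
    proof (rule reduced_resolvent_eqI)
      have "- L (cscale c (reduced_resolvent X)) = cscale c (- L (reduced_resolvent X))"
        using T(1)[OF X] by (simp add: linear_mapD[OF linear] uminus_eq_cscale cscale_cscale mult.commute)
      then show "- L (cscale c (reduced_resolvent X)) = cscale c X - proj (cscale c X)"
        using X by (simp add: T(3) linear_mapD[OF proj_linear] cscale_diff)
    qed (use T[OF X] in \<open>auto simp: closed linear_mapD[OF proj_linear]\<close>)
  qed (rule T)
  have TL: "reduced_resolvent (- L X) = X - proj X" if X: "X \<in> M" for X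
  proof (rule reduced_resolvent_eqI)
    show "X - proj X \<in> M" using X by (simp add: closed proj_M)
    show "proj (X - proj X) = 0"
      using X by (simp add: linear_map_diff[OF algebra proj_linear] proj_M proj_fixed proj_N)
    have "L (X - proj X) = L X"
      using X proj_N[OF X] by (simp add: linear_map_diff[OF algebra linear] proj_M N_iff)
    moreover have "proj (- L X) = 0"
      using X by (simp add: linear_mapD[OF proj_linear] linear_mapD[OF linear] proj_range)
    ultimately show "- L (X - proj X) = - L X - proj (- L X)" by simp
  qed
  have adj: "kms_adjoint M \<sigma> \<Psi> X = X - proj X"
    if "X \<in> M" "\<And>Z. Z \<in> M \<Longrightarrow> \<Psi> Z = Z - proj Z" for X \<Psi>
    using that by (intro kms_adjoint_eqI) (auto simp: closed proj_M kms_inner_diff proj_symmetric)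
  show ?thesis unfolding is_pseudoinverse_def
  proof (intro conjI ballI)
    fix X assume X: "X \<in> M"
    have LX: "- L X \<in> M" using X linear_mapD(1)[OF linear] by (simp add: closed)
    have "proj (- L X) = 0"
      using X by (simp add: linear_mapD[OF proj_linear] linear_mapD[OF linear] proj_range)
    then show "- L (reduced_resolvent (- L X)) = - L X" using T(3)[OF LX] by simp
    show "reduced_resolvent (- L (reduced_resolvent X)) = reduced_resolvent X"
      using TL[OF T(1)[OF X]] T(2)[OF X] by simp
    show "kms_adjoint M \<sigma> ((\<lambda>Y. - L Y) \<circ> reduced_resolvent) X = - L (reduced_resolvent X)"
      using adj[OF X, of "(\<lambda>Y. - L Y) \<circ> reduced_resolvent"] by (simp add: T(3) X)
    show "kms_adjoint M \<sigma> (reduced_resolvent \<circ> (\<lambda>Y. - L Y)) X = reduced_resolvent (- L X)"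
      using adj[OF X, of "reduced_resolvent \<circ> (\<lambda>Y. - L Y)"] by (simp add: TL X)
  qed (rule lin)
qed

lemma pseudoinverse_works:
  shows "linear_map M (pseudoinverse M \<sigma> (\<lambda>Y. - L Y))"
    and "Y \<in> M \<Longrightarrow> proj Y = 0 \<Longrightarrow> L (pseudoinverse M \<sigma> (\<lambda>Y. - L Y) Y) = - Y"
proof -
  define T where "T = pseudoinverse M \<sigma> (\<lambda>Y. - L Y)"
  have T: "is_pseudoinverse M \<sigma> (\<lambda>Y. - L Y) T"
    unfolding T_def pseudoinverse_def
    using someI[of "is_pseudoinverse M \<sigma> (\<lambda>Y. - L Y)", OF reduced_resolvent_is_pseudoinverse] .
  then show "linear_map M (pseudoinverse M \<sigma> (\<lambda>Y. - L Y))"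
    by (simp add: is_pseudoinverse_def T_def)
  assume Y: "Y \<in> M" "proj Y = 0"
  then obtain V where V: "V \<in> M" "Y = L V" by (rule proj_zero_range)
  have "- L (T (- L (- V))) = - L (- V)"
    using T V(1) closed(7) unfolding is_pseudoinverse_def by blast
  moreover have "L (- V) = - Y" using V by (simp add: linear_mapD[OF linear])
  ultimately have "- L (T Y) = Y" by simp
  then show "L (pseudoinverse M \<sigma> (\<lambda>Y. - L Y) Y) = - Y" unfolding T_def by (metis minus_minus)
qed

end

section \<open>Diffusive averaging of a skew flow with strong dissipation\<close>

text \<open>Gronwall's argument for a forced dissipative equation, in the seminorm \<open>x \<mapsto> \<parallel>J x\<parallel>\<close>. Only an upper
  bound on \<open>\<langle>J x, J (G x)\<rangle>\<close> enters, so the estimate does not see the size of \<open>G\<close>.\<close>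

lemma dissipative_energy_estimate:
  fixes J :: "'a::euclidean_space \<Rightarrow> 'b::euclidean_space" and e :: "real \<Rightarrow> 'a"
  assumes J: "linear J"
    and e: "\<And>s. 0 \<le> s \<Longrightarrow> (e has_vector_derivative (G (e s) + r s)) (at s within {0..})"
    and diss: "\<And>s. 0 \<le> s \<Longrightarrow> inner (J (e s)) (J (G (e s))) \<le> 0"
    and r: "\<And>s. 0 \<le> s \<Longrightarrow> s \<le> t \<Longrightarrow> norm (J (r s)) \<le> \<delta>"
    and t: "0 \<le> t"
  shows "(norm (J (e t)))\<^sup>2 \<le> exp t * ((norm (J (e 0)))\<^sup>2 + \<delta>\<^sup>2 * t)"
proof -
  define E where "E s = inner (J (e s)) (J (e s))" for s
  define \<phi> where "\<phi> s = exp (- s) * E s - \<delta>\<^sup>2 * s" for s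
  have bJ: "bounded_linear J" using J by (simp add: linear_conv_bounded_linear)
  have dJ: "((\<lambda>s. J (e s)) has_vector_derivative J (G (e s) + r s)) (at s within {0..})" if "0 \<le> s" for s
    by (rule bounded_linear.has_vector_derivative[OF bJ e[OF that]])
  have dE: "(E has_real_derivative 2 * inner (J (e s)) (J (G (e s) + r s))) (at s within {0..})"
    if "0 \<le> s" for s
    unfolding E_def has_real_derivative_iff_has_vector_derivative
    using bounded_bilinear.has_vector_derivative[OF bounded_bilinear_inner dJ[OF that] dJ[OF that]]
    by (simp add: inner_commute)
  have d\<phi>: "(\<phi> has_real_derivative
      exp (- s) * (2 * inner (J (e s)) (J (G (e s) + r s)) - E s) - \<delta>\<^sup>2) (at s within {0..})"
    if "0 \<le> s" for s
    unfolding \<phi>_def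
    by (rule derivative_eq_intros dE[OF that] refl)+ (simp add: algebra_simps)
  have "\<phi> t \<le> \<phi> 0"
  proof (rule DERIV_nonpos_imp_decreasing_open[OF t])
    fix s assume s: "0 < s" "s < t"
    then have "s \<in> interior {0..}" by (simp add: interior_real_atLeast)
    then have "at s within {0..} = at s" by (rule at_within_interior)
    then have "(\<phi> has_real_derivative
      exp (- s) * (2 * inner (J (e s)) (J (G (e s) + r s)) - E s) - \<delta>\<^sup>2) (at s)"
      using d\<phi>[of s] s by (metis less_imp_le)
    moreover have "exp (- s) * (2 * inner (J (e s)) (J (G (e s) + r s)) - E s) - \<delta>\<^sup>2 \<le> 0"
    proof -
      have "inner (J (e s)) (J (G (e s) + r s)) \<le> inner (J (e s)) (J (r s))"
        using diss[of s] s by (simp add: linear_add[OF J] inner_add_right)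
      also have "\<dots> \<le> norm (J (e s)) * norm (J (r s))" by (rule norm_cauchy_schwarz)
      also have "\<dots> \<le> norm (J (e s)) * \<delta>" using r[of s] s by (intro mult_left_mono) auto
      finally have "2 * inner (J (e s)) (J (G (e s) + r s)) - E s \<le> 2 * (norm (J (e s)) * \<delta>) - E s"
        by simp
      also have "\<dots> \<le> \<delta>\<^sup>2"
        using zero_le_power2[of "norm (J (e s)) - \<delta>"]
        by (simp add: E_def power2_norm_eq_inner[symmetric] power2_diff)
      finally have "exp (- s) * (2 * inner (J (e s)) (J (G (e s) + r s)) - E s) \<le> exp (- s) * \<delta>\<^sup>2"
        by (intro mult_left_mono) auto
      also have "\<dots> \<le> 1 * \<delta>\<^sup>2" using s by (intro mult_right_mono) auto
      finally show ?thesis by simp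
    qed
    ultimately show "\<exists>y. (\<phi> has_real_derivative y) (at s) \<and> y \<le> 0" by blast
  next
    have "continuous_on {0..} \<phi>"
      using d\<phi> by (intro DERIV_continuous_on) auto
    then show "continuous_on {0..t} \<phi>" by (rule continuous_on_subset) auto
  qed
  then have "exp (- t) * E t \<le> E 0 + \<delta>\<^sup>2 * t" by (simp add: \<phi>_def)
  then have "exp t * (exp (- t) * E t) \<le> exp t * (E 0 + \<delta>\<^sup>2 * t)" by (intro mult_left_mono) auto
  then show ?thesis by (simp add: E_def power2_norm_eq_inner exp_minus field_simps)
qed

lemma linear_bounded_along_path:
  fixes F :: "'a::euclidean_space \<Rightarrow> 'b::euclidean_space" and x :: "real \<Rightarrow> 'a"
  assumes "continuous_on {0..t} x" "linear F"
  obtains b where "0 \<le> b" "\<And>s. 0 \<le> s \<Longrightarrow> s \<le> t \<Longrightarrow> norm (F (x s)) \<le> b"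
proof -
  have "continuous_on {0..t} (\<lambda>s. F (x s))"
    using assms by (auto intro: bounded_linear.continuous_on simp: linear_conv_bounded_linear)
  then have "bounded ((\<lambda>s. F (x s)) ` {0..t})"
    by (intro compact_imp_bounded compact_continuous_image) auto
  then obtain b where b: "\<forall>s\<in>{0..t}. norm (F (x s)) \<le> b" by (auto simp: bounded_iff)
  show thesis by (rule that[of "max b 0"]) (use b in \<open>auto simp: le_max_iff_disj\<close>)
qed

text \<open>With \<open>x\<^sub>1 = T A x\<^sub>0\<close> and \<open>x\<^sub>2 = T (A x\<^sub>1 - x\<^sub>0')\<close> the expansion \<open>x\<^sub>0 + \<epsilon> x\<^sub>1 + \<epsilon>\<^sup>2 x\<^sub>2\<close> solves the
  singular equation up to a residual of order \<open>\<epsilon>\<close>: the orders \<open>\<epsilon>\<^sup>-\<^sup>1\<close> and \<open>1\<close> cancel by \<open>S x\<^sub>1 = - A x\<^sub>0\<close>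
  and \<open>S x\<^sub>2 = x\<^sub>0' - A x\<^sub>1\<close>. Solvability of the first is \<open>E A E = 0\<close>, that of the second is the limit
  equation. Since \<open>A\<close> is skew and \<open>S\<close> dissipative, the residual is not amplified.\<close>

theorem diffusive_averaging:
  fixes J :: "'a::euclidean_space \<Rightarrow> 'b::euclidean_space" and A S T E :: "'a \<Rightarrow> 'a"
    and x :: "real \<Rightarrow> real \<Rightarrow> 'a" and x0 :: "real \<Rightarrow> 'a"
  assumes M: "subspace M"
    and lin: "linear J" "linear A" "linear S" "linear T" "linear E"
    and maps: "\<And>y. y \<in> M \<Longrightarrow> A y \<in> M" "\<And>y. y \<in> M \<Longrightarrow> S y \<in> M"
      "\<And>y. y \<in> M \<Longrightarrow> T y \<in> M" "\<And>y. y \<in> M \<Longrightarrow> E y \<in> M"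
    and skew: "\<And>y. y \<in> M \<Longrightarrow> inner (J y) (J (A y)) = 0"
    and diss: "\<And>y. y \<in> M \<Longrightarrow> inner (J y) (J (S y)) \<le> 0"
    and E_kernel: "\<And>y. y \<in> M \<Longrightarrow> S (E y) = 0" "\<And>y. y \<in> M \<Longrightarrow> S y = 0 \<Longrightarrow> E y = y"
    and T_inverse: "\<And>y. y \<in> M \<Longrightarrow> E y = 0 \<Longrightarrow> S (T y) = - y"
    and centred: "\<And>y. y \<in> M \<Longrightarrow> E (A (E y)) = 0"
    and x_in: "\<And>\<epsilon> t. \<epsilon> > 0 \<Longrightarrow> t \<ge> 0 \<Longrightarrow> x \<epsilon> t \<in> M"
    and x_ode: "\<And>\<epsilon> t. \<epsilon> > 0 \<Longrightarrow> t \<ge> 0 \<Longrightarrow>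
      (x \<epsilon> has_vector_derivative (inverse \<epsilon> *\<^sub>R A (x \<epsilon> t) + inverse (\<epsilon>\<^sup>2) *\<^sub>R S (x \<epsilon> t))) (at t within {0..})"
    and x0_in: "\<And>t. t \<ge> 0 \<Longrightarrow> x0 t \<in> M"
    and x0_ode: "\<And>t. t \<ge> 0 \<Longrightarrow>
      (x0 has_vector_derivative E (A (T (A (E (x0 t)))))) (at t within {0..})"
    and x0_start: "S (x0 0) = 0" and start: "\<And>\<epsilon>. \<epsilon> > 0 \<Longrightarrow> x \<epsilon> 0 = x0 0"
    and t: "0 \<le> t"
  shows "(\<lambda>\<epsilon>. norm (J (x \<epsilon> t - x0 t))) \<in> O[at_right 0](\<lambda>\<epsilon>. \<epsilon>)"
proof -
  define K where "K = E \<circ> A \<circ> T \<circ> A \<circ> E"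
  define C1 where "C1 = T \<circ> A"
  define C2 where "C2 = (\<lambda>y. T (A (C1 y) - K y))"
  define R1 where "R1 = (\<lambda>y. C1 (K y) - A (C2 y))"
  have linK: "linear K" and linC1: "linear C1"
    unfolding K_def C1_def by (intro linear_compose lin)+
  have linC2: "linear C2"
    using linear_compose[OF linear_compose_sub[OF linear_compose[OF linC1 lin(2)] linK] lin(4)]
    by (simp add: C2_def o_def)
  have linR1: "linear R1"
    using linear_compose_sub[OF linear_compose[OF linK linC1] linear_compose[OF linC2 lin(2)]]
    by (simp add: R1_def o_def)
  have bl: "bounded_linear F" if "linear F" for F :: "'a \<Rightarrow> 'a"
    using that by (simp add: linear_conv_bounded_linear)
  have K_in: "K y \<in> M" and C1_in: "C1 y \<in> M" and C2_in: "C2 y \<in> M" if "y \<in> M" for y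
    using that by (auto simp: K_def C1_def C2_def intro!: maps subspace_diff[OF M])

  have dx0: "(x0 has_vector_derivative K (x0 s)) (at s within {0..})" if "s \<ge> 0" for s
    using x0_ode[OF that] by (simp add: K_def)
  have Sx0: "S (x0 s) = 0" if "s \<ge> 0" for s
  proof -
    have "((\<lambda>s. S (x0 s)) has_vector_derivative 0) (at s within {0..})" if "s \<in> {0..}" for s
    proof -
      have "S (K (x0 s)) = 0" using x0_in[of s] that by (auto simp: K_def intro!: E_kernel maps)
      then show ?thesis
        using bounded_linear.has_vector_derivative[OF bl[OF lin(3)] dx0[of s]] that by simp
    qed
    then obtain c where "\<And>s. s \<in> {0..} \<Longrightarrow> S (x0 s) = c"
      using has_vector_derivative_zero_constant[of "{0..}" "\<lambda>s. S (x0 s)"] convex_real_interval(1)[of 0] by blast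
    then show ?thesis using x0_start that by fastforce
  qed
  have Ex0: "E (x0 s) = x0 s" if "s \<ge> 0" for s using Sx0 x0_in that by (intro E_kernel) auto

  have SC1: "S (C1 (x0 s)) = - A (x0 s)" if "s \<ge> 0" for s
  proof -
    have "E (A (x0 s)) = 0" using centred[OF x0_in[OF that]] Ex0[OF that] by simp
    then show ?thesis using x0_in[OF that] by (simp add: C1_def T_inverse maps)
  qed
  have SC2: "S (C2 (x0 s)) = K (x0 s) - A (C1 (x0 s))" if s: "s \<ge> 0" for s
  proof -
    have "E (K (x0 s)) = K (x0 s)" using x0_in[OF s] by (auto simp: K_def intro!: E_kernel maps)
    moreover have "E (A (C1 (x0 s))) = K (x0 s)" using Ex0[OF s] by (simp add: K_def C1_def)
    ultimately have "E (A (C1 (x0 s)) - K (x0 s)) = 0" by (simp add: linear_diff[OF lin(5)])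
    then have "S (T (A (C1 (x0 s)) - K (x0 s))) = - (A (C1 (x0 s)) - K (x0 s))"
      using x0_in[OF s] by (intro T_inverse subspace_diff[OF M] maps K_in C1_in)
    then show ?thesis by (simp add: C2_def)
  qed

  have cont: "continuous_on {0..t} x0"
  proof -
    have "continuous_on {0..} x0" using dx0 by (intro continuous_on_vector_derivative) auto
    then show ?thesis by (rule continuous_on_subset) auto
  qed
  obtain b1 where b1: "0 \<le> b1" "\<And>s. 0 \<le> s \<Longrightarrow> s \<le> t \<Longrightarrow> norm (J (R1 (x0 s))) \<le> b1"
    using linear_bounded_along_path[OF cont linear_compose[OF linR1 lin(1)]] by auto
  obtain b2 where b2: "0 \<le> b2" "\<And>s. 0 \<le> s \<Longrightarrow> s \<le> t \<Longrightarrow> norm (J (C2 (K (x0 s)))) \<le> b2"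
    using linear_bounded_along_path[OF cont linear_compose[OF linear_compose[OF linK linC2] lin(1)]] by auto
  obtain b3 where b3: "0 \<le> b3" "\<And>s. 0 \<le> s \<Longrightarrow> s \<le> t \<Longrightarrow> norm (J (C1 (x0 s))) \<le> b3"
    using linear_bounded_along_path[OF cont linear_compose[OF linC1 lin(1)]] by auto
  obtain b4 where b4: "0 \<le> b4" "\<And>s. 0 \<le> s \<Longrightarrow> s \<le> t \<Longrightarrow> norm (J (C2 (x0 s))) \<le> b4"
    using linear_bounded_along_path[OF cont linear_compose[OF linC2 lin(1)]] by auto
  define c where "c = sqrt (exp t * ((b3 + b4)\<^sup>2 + (b1 + b2)\<^sup>2 * t))"

  have J_sum: "norm (J (\<epsilon> *\<^sub>R y + \<epsilon>\<^sup>2 *\<^sub>R z)) \<le> \<epsilon> * (p + q)"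
    if "0 < \<epsilon>" "\<epsilon> < 1" "norm (J y) \<le> p" "norm (J z) \<le> q" for \<epsilon> y z p q
  proof -
    have "norm (J (\<epsilon> *\<^sub>R y + \<epsilon>\<^sup>2 *\<^sub>R z)) \<le> \<epsilon> * norm (J y) + \<epsilon>\<^sup>2 * norm (J z)"
      using norm_triangle_ineq[of "\<epsilon> *\<^sub>R J y" "\<epsilon>\<^sup>2 *\<^sub>R J z"] that
      by (simp add: linear_add[OF lin(1)] linear_scale[OF lin(1)])
    also have "\<dots> \<le> \<epsilon> * p + \<epsilon> * q"
    proof (intro add_mono mult_mono)
      show "\<epsilon>\<^sup>2 \<le> \<epsilon>" using that by (simp add: power2_eq_square)
    qed (use that in auto)
    finally show ?thesis by (simp add: distrib_left)
  qed

  have main: "norm (J (x \<epsilon> t - x0 t)) \<le> (c + b3 + b4) * \<epsilon>" if \<epsilon>: "0 < \<epsilon>" "\<epsilon> < 1" for \<epsilon>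
  proof -
    define z where "z s = x0 s + (\<epsilon> *\<^sub>R C1 (x0 s) + \<epsilon>\<^sup>2 *\<^sub>R C2 (x0 s))" for s
    define e where "e s = x \<epsilon> s - z s" for s
    define G where "G y = inverse \<epsilon> *\<^sub>R A y + inverse (\<epsilon>\<^sup>2) *\<^sub>R S y" for y
    define r where "r s = - (\<epsilon> *\<^sub>R R1 (x0 s) + \<epsilon>\<^sup>2 *\<^sub>R C2 (K (x0 s)))" for s
    have z_in: "z s \<in> M" if "s \<ge> 0" for s
      unfolding z_def
      by (intro subspace_add[OF M] subspace_scale[OF M] C1_in C2_in x0_in that)
    have dz: "(z has_vector_derivative (K (x0 s) + (\<epsilon> *\<^sub>R C1 (K (x0 s)) + \<epsilon>\<^sup>2 *\<^sub>R C2 (K (x0 s)))))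
        (at s within {0..})" if "s \<ge> 0" for s
      unfolding z_def
      by (intro has_vector_derivative_add dx0 that
          bounded_linear.has_vector_derivative[OF bounded_linear_scaleR_right]
          bounded_linear.has_vector_derivative[OF bl[OF linC1]]
          bounded_linear.has_vector_derivative[OF bl[OF linC2]])
    have Gz: "G (z s) = K (x0 s) + \<epsilon> *\<^sub>R A (C2 (x0 s))" if "s \<ge> 0" for s
    proof -
      have Az: "A (z s) = A (x0 s) + (\<epsilon> *\<^sub>R A (C1 (x0 s)) + \<epsilon>\<^sup>2 *\<^sub>R A (C2 (x0 s)))"
        by (simp add: z_def linear_add[OF lin(2)] linear_scale[OF lin(2)])
      have Sz: "S (z s) = - (\<epsilon> *\<^sub>R A (x0 s)) + \<epsilon>\<^sup>2 *\<^sub>R (K (x0 s) - A (C1 (x0 s)))"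
        using that
        by (simp add: z_def linear_add[OF lin(3)] linear_scale[OF lin(3)] SC1 SC2 Sx0)
      have "inverse \<epsilon> * \<epsilon> = 1" "inverse \<epsilon> * \<epsilon>\<^sup>2 = \<epsilon>" "inverse (\<epsilon>\<^sup>2) * \<epsilon> = inverse \<epsilon>"
        "inverse (\<epsilon>\<^sup>2) * \<epsilon>\<^sup>2 = 1"
        using \<epsilon> by (auto simp: power2_eq_square field_simps)
      then show ?thesis
        by (simp only: G_def Az Sz scaleR_add_right scaleR_minus_right scaleR_scaleR scaleR_one) simp
    qed
    have G_diff: "G (y - w) = G y - G w" for y w
      by (simp add: G_def linear_diff[OF lin(2)] linear_diff[OF lin(3)] scaleR_diff_right)
    have de: "(e has_vector_derivative (G (e s) + r s)) (at s within {0..})" if s: "0 \<le> s" for s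
    proof -
      have "(e has_vector_derivative (G (x \<epsilon> s)
          - (K (x0 s) + (\<epsilon> *\<^sub>R C1 (K (x0 s)) + \<epsilon>\<^sup>2 *\<^sub>R C2 (K (x0 s)))))) (at s within {0..})"
        unfolding e_def G_def by (intro has_vector_derivative_diff dz s x_ode \<epsilon>)
      moreover have "G (x \<epsilon> s) - (K (x0 s) + (\<epsilon> *\<^sub>R C1 (K (x0 s)) + \<epsilon>\<^sup>2 *\<^sub>R C2 (K (x0 s))))
          = G (e s) + r s"
        by (simp add: e_def G_diff Gz[OF s] r_def R1_def scaleR_diff_right)
      ultimately show ?thesis by simp
    qed
    have "(norm (J (e t)))\<^sup>2 \<le> exp t * ((norm (J (e 0)))\<^sup>2 + (\<epsilon> * (b1 + b2))\<^sup>2 * t)"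
    proof (rule dissipative_energy_estimate[OF lin(1) de _ _ t])
      fix s :: real assume s: "0 \<le> s"
      have "e s \<in> M" using s \<epsilon> by (simp add: e_def subspace_diff[OF M] x_in z_in)
      then have "inverse \<epsilon> * inner (J (e s)) (J (A (e s))) + inverse (\<epsilon>\<^sup>2) * inner (J (e s)) (J (S (e s))) \<le> 0"
        using skew diss \<epsilon> by (simp add: mult_nonneg_nonpos)
      then show "inner (J (e s)) (J (G (e s))) \<le> 0"
        by (simp add: G_def linear_add[OF lin(1)] linear_scale[OF lin(1)] inner_add_right)
      assume "s \<le> t"
      then show "norm (J (r s)) \<le> \<epsilon> * (b1 + b2)"
        using J_sum[OF \<epsilon> b1(2)[OF s] b2(2)[OF s]] by (simp only: r_def linear_neg[OF lin(1)] norm_minus_cancel)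
    qed
    also have "\<dots> \<le> exp t * ((\<epsilon> * (b3 + b4))\<^sup>2 + (\<epsilon> * (b1 + b2))\<^sup>2 * t)"
    proof -
      have "e 0 = - (\<epsilon> *\<^sub>R C1 (x0 0) + \<epsilon>\<^sup>2 *\<^sub>R C2 (x0 0))" using start[OF \<epsilon>(1)] by (simp add: e_def z_def)
      then have "norm (J (e 0)) = norm (J (\<epsilon> *\<^sub>R C1 (x0 0) + \<epsilon>\<^sup>2 *\<^sub>R C2 (x0 0)))"
        by (simp only: linear_neg[OF lin(1)] norm_minus_cancel)
      then have "norm (J (e 0)) \<le> \<epsilon> * (b3 + b4)"
        using J_sum[OF \<epsilon> b3(2) b4(2), of 0 0] t by simp
      then show ?thesis by (intro mult_left_mono add_right_mono power_mono) auto
    qed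
    also have "\<dots> = (\<epsilon> * c)\<^sup>2"
    proof -
      have "c\<^sup>2 = exp t * ((b3 + b4)\<^sup>2 + (b1 + b2)\<^sup>2 * t)" using t by (simp add: c_def)
      then show ?thesis by (simp only: power_mult_distrib) (simp only: distrib_left mult_ac)
    qed
    finally have "norm (J (e t)) \<le> \<epsilon> * c"
      using \<epsilon> t by (simp add: power2_le_iff_abs_le c_def)
    moreover have "x \<epsilon> t - x0 t = e t + (\<epsilon> *\<^sub>R C1 (x0 t) + \<epsilon>\<^sup>2 *\<^sub>R C2 (x0 t))"
      by (simp add: e_def z_def)
    then have "norm (J (x \<epsilon> t - x0 t))
        \<le> norm (J (e t)) + norm (J (\<epsilon> *\<^sub>R C1 (x0 t) + \<epsilon>\<^sup>2 *\<^sub>R C2 (x0 t)))"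
      by (simp only: linear_add[OF lin(1), of "e t"] norm_triangle_ineq)
    moreover have "norm (J (\<epsilon> *\<^sub>R C1 (x0 t) + \<epsilon>\<^sup>2 *\<^sub>R C2 (x0 t))) \<le> \<epsilon> * (b3 + b4)"
      using t by (intro J_sum \<epsilon> b3 b4) auto
    ultimately show ?thesis by (simp add: algebra_simps)
  qed
  show ?thesis
  proof (rule bigoI)
    have "eventually (\<lambda>\<epsilon>. 0 < \<epsilon> \<and> \<epsilon> < 1) (at_right (0::real))"
      by (simp add: eventually_at_right_field) (auto intro: exI[of _ 1])
    then show "\<forall>\<^sub>F \<epsilon> in at_right 0. norm (norm (J (x \<epsilon> t - x0 t))) \<le> (c + b3 + b4) * norm \<epsilon>"
      by eventually_elim (use main in auto)
  qed
qed

section \<open>Averaging of quantum Markov semigroups\<close>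

lemma kms_dissipator_of_generator_family:
  assumes vN: "von_neumann_algebra M" and lin: "linear_map M L\<^sub>S"
    and gen: "\<And>\<gamma>. \<gamma> > 0 \<Longrightarrow> qms_generator M (\<lambda>Y. L\<^sub>A Y + \<gamma> *\<^sub>R L\<^sub>S Y)"
    and density: "\<sigma> \<in> full_rank_densities M"
    and sym: "\<And>Y. Y \<in> M \<Longrightarrow> L\<^sub>S Y = kms_adjoint M \<sigma> L\<^sub>S Y"
  shows "kms_dissipator M \<sigma> L\<^sub>S"
proof
  interpret kms_algebra M \<sigma> by standard (fact vN density)+
  show "von_neumann_algebra M" "\<sigma> \<in> full_rank_densities M" "linear_map M L\<^sub>S" by fact+
  show "conditionally_cp M L\<^sub>S"
    by (rule conditionally_cp_leading_part) (rule qms_generator_conditionally_cp[OF vN gen])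
  show "L\<^sub>S (mat 1) = 0"
    using qms_generator_one[OF vN gen[of 1]] qms_generator_one[OF vN gen[of 2]]
    by (simp add: scaleR_2 eq_neg_iff_add_eq_0[symmetric])
  fix X Y assume "X \<in> M" "Y \<in> M"
  then show "kms_inner \<sigma> (L\<^sub>S X) Y = kms_inner \<sigma> X (L\<^sub>S Y)"
    using kms_adjoint_works[OF lin, of X Y] sym[of Y] by simp
qed

theorem proposition2p12:
  fixes M :: "'n::finite cmat set"
    and \<sigma> :: "'n cmat"
    and L\<^sub>A L\<^sub>S E\<^sub>S :: "'n cmat \<Rightarrow> 'n cmat"
    and L :: "real \<Rightarrow> 'n cmat \<Rightarrow> 'n cmat"
    and X :: "real \<Rightarrow> real \<Rightarrow> 'n cmat"
    and X\<^sub>0 :: "real \<Rightarrow> 'n cmat"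
  defines "L \<equiv> \<lambda>\<gamma> Y. L\<^sub>A Y + \<gamma> *\<^sub>R L\<^sub>S Y"
    and "E\<^sub>S \<equiv> cond_exp M \<sigma> (fixed_points M L\<^sub>S)"
  assumes "von_neumann_algebra M"
    and "linear_map M L\<^sub>A" and "linear_map M L\<^sub>S"
    and "\<And>\<gamma>. \<gamma> > 0 \<Longrightarrow> qms_generator M (L \<gamma>)"
    and "\<sigma> \<in> full_rank_densities M"
    and "\<And>Y. Y \<in> M \<Longrightarrow> L\<^sub>S Y = kms_adjoint M \<sigma> L\<^sub>S Y"
    and "\<And>Y. Y \<in> M \<Longrightarrow> L\<^sub>A Y = - kms_adjoint M \<sigma> L\<^sub>A Y"
    and "\<And>\<gamma>. \<gamma> > 0 \<Longrightarrow> cdim (fixed_points M L\<^sub>S) > cdim (fixed_points M (L \<gamma>))"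
    and "\<And>Y. Y \<in> M \<Longrightarrow> E\<^sub>S (L\<^sub>A (E\<^sub>S Y)) = 0"
    and "\<And>\<epsilon> t. \<epsilon> > 0 \<Longrightarrow> t \<ge> 0 \<Longrightarrow> X \<epsilon> t \<in> M"
    and "\<And>\<epsilon> t. \<epsilon> > 0 \<Longrightarrow> t \<ge> 0 \<Longrightarrow>
      (X \<epsilon> has_vector_derivative
        (inverse \<epsilon> *\<^sub>R L\<^sub>A (X \<epsilon> t) + inverse (\<epsilon>\<^sup>2) *\<^sub>R L\<^sub>S (X \<epsilon> t))) (at t within {0..})"
    and "\<And>t. t \<ge> 0 \<Longrightarrow> X\<^sub>0 t \<in> M"
    and "\<And>t. t \<ge> 0 \<Longrightarrow>
      (X\<^sub>0 has_vector_derivative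
        - kms_adjoint M \<sigma> (L\<^sub>A \<circ> E\<^sub>S)
            (pseudoinverse M \<sigma> (\<lambda>Y. - L\<^sub>S Y) ((L\<^sub>A \<circ> E\<^sub>S) (X\<^sub>0 t)))) (at t within {0..})"
    and "X\<^sub>0 0 \<in> fixed_points M L\<^sub>S"
    and "\<And>\<epsilon>. \<epsilon> > 0 \<Longrightarrow> X \<epsilon> 0 = X\<^sub>0 0"
  shows "\<forall>t\<ge>0. (\<lambda>\<epsilon>. kms_norm \<sigma> (X \<epsilon> t - X\<^sub>0 t)) \<in> O[at_right 0](\<lambda>\<epsilon>. \<epsilon>)"
proof (intro allI impI)
  fix t :: real assume t: "0 \<le> t"
  note vN = assms(3) and linA = assms(4) and linS = assms(5)
  interpret kms_dissipator M \<sigma> L\<^sub>S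
    using vN linS assms(6) assms(7,8) unfolding L_def by (rule kms_dissipator_of_generator_family)
  define T where "T = pseudoinverse M \<sigma> (\<lambda>Y. - L\<^sub>S Y)"
  have E: "E\<^sub>S Y = proj Y" if "Y \<in> M" for Y using cond_exp_eq_proj[OF that] by (simp add: E\<^sub>S_def)
  have linT: "linear_map M T" unfolding T_def by (rule pseudoinverse_works)
  note A_in = linear_mapD(1)[OF linA] and T_in = linear_mapD(1)[OF linT]
  have skew: "kms_inner \<sigma> (L\<^sub>A Y) Z = - kms_inner \<sigma> Y (L\<^sub>A Z)" if "Y \<in> M" "Z \<in> M" for Y Z
  proof -
    have "kms_adjoint M \<sigma> L\<^sub>A Z = cscale (- 1) (L\<^sub>A Z)"
      using assms(9)[OF that(2)] by (metis minus_minus uminus_eq_cscale)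
    then show ?thesis using kms_adjoint_works[OF linA that(1), of Z] by (simp add: kms_inner_cscale)
  qed
  have J_skew: "inner (J Y) (J (L\<^sub>A Y)) = 0" if "Y \<in> M" for Y
    using arg_cong[OF skew[OF that that], of Re] by (simp add: Re_kms_inner inner_commute)
  \<comment> \<open>The adjoint of \<open>L\<^sub>A E\<^sub>S\<close> is \<open>- E\<^sub>S L\<^sub>A\<close>, so the limit equation reads \<open>X\<^sub>0' = E\<^sub>S L\<^sub>A T L\<^sub>A E\<^sub>S X\<^sub>0\<close>.\<close>
  have adj: "- kms_adjoint M \<sigma> (L\<^sub>A \<circ> E\<^sub>S) Y = proj (L\<^sub>A Y)" if Y: "Y \<in> M" for Y
  proof -
    have "kms_adjoint M \<sigma> (L\<^sub>A \<circ> E\<^sub>S) Y = cscale (- 1) (proj (L\<^sub>A Y))"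
    proof (rule kms_adjoint_eqI)
      show "cscale (- 1) (proj (L\<^sub>A Y)) \<in> M" using Y by (intro closed(5) proj_M A_in)
      fix Z assume Z: "Z \<in> M"
      show "kms_inner \<sigma> ((L\<^sub>A \<circ> E\<^sub>S) Z) Y = kms_inner \<sigma> Z (cscale (- 1) (proj (L\<^sub>A Y)))"
        using skew[OF proj_M[OF Z] Y] proj_symmetric[OF Z A_in[OF Y]]
        by (simp add: E[OF Z] kms_inner_cscale)
    qed
    then show ?thesis by (metis minus_minus uminus_eq_cscale)
  qed
  obtain A' where A': "linear A'" "\<And>Y. Y \<in> M \<Longrightarrow> A' Y = L\<^sub>A Y" using linear_map_extend[OF vN linA] by blast
  obtain S' where S': "linear S'" "\<And>Y. Y \<in> M \<Longrightarrow> S' Y = L\<^sub>S Y" using linear_map_extend[OF vN linS] by blast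
  obtain T' where T': "linear T'" "\<And>Y. Y \<in> M \<Longrightarrow> T' Y = T Y" using linear_map_extend[OF vN linT] by blast
  obtain E' where E': "linear E'" "\<And>Y. Y \<in> M \<Longrightarrow> E' Y = proj Y"
    using linear_map_extend[OF vN proj_linear] by blast
  have "(\<lambda>\<epsilon>. norm (J (X \<epsilon> t - X\<^sub>0 t))) \<in> O[at_right 0](\<lambda>\<epsilon>. \<epsilon>)"
  proof (rule diffusive_averaging[OF von_neumann_algebra_subspace[OF vN] linear_J A'(1) S'(1) T'(1) E'(1)
        _ _ _ _ _ _ _ _ _ _ _ _ _ _ _ _ t])
    fix Y assume Y: "Y \<in> M"
    show "A' Y \<in> M" "S' Y \<in> M" "T' Y \<in> M" "E' Y \<in> M"
      using Y by (simp_all add: A' S' T' E' A_in T_in proj_M linear_mapD(1)[OF linS])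
    show "inner (J Y) (J (A' Y)) = 0" "inner (J Y) (J (S' Y)) \<le> 0"
      using Y J_skew dissipative by (simp_all add: A' S')
    show "S' (E' Y) = 0" using proj_N[OF Y] Y by (simp add: E' S' N_iff)
    show "S' Y = 0 \<Longrightarrow> E' Y = Y" using Y proj_fixed[of Y] by (simp add: E' S' N_iff)
    show "E' Y = 0 \<Longrightarrow> S' (T' Y) = - Y"
      using Y pseudoinverse_works(2)[of Y] by (simp add: E' S' T' T_in) (simp add: T_def)
    show "E' (A' (E' Y)) = 0"
      using assms(11)[OF Y] Y by (simp add: E' A' E proj_M A_in)
  next
    fix \<epsilon> s :: real assume *: "\<epsilon> > 0" "s \<ge> 0"
    show "X \<epsilon> s \<in> M" using * by (rule assms(12))
    then show "(X \<epsilon> has_vector_derivative (inverse \<epsilon> *\<^sub>R A' (X \<epsilon> s) + inverse (\<epsilon>\<^sup>2) *\<^sub>R S' (X \<epsilon> s)))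
        (at s within {0..})"
      using assms(13)[OF *] by (simp add: A' S')
  next
    fix s :: real assume s: "s \<ge> 0"
    show X0: "X\<^sub>0 s \<in> M" using s by (rule assms(14))
    have "E' (A' (T' (A' (E' (X\<^sub>0 s))))) = proj (L\<^sub>A (T (L\<^sub>A (proj (X\<^sub>0 s)))))"
      using X0 by (simp add: E' A' T' proj_M A_in T_in)
    also have "\<dots> = - kms_adjoint M \<sigma> (L\<^sub>A \<circ> E\<^sub>S) (T ((L\<^sub>A \<circ> E\<^sub>S) (X\<^sub>0 s)))"
      using X0 by (simp add: adj E proj_M A_in T_in)
    finally show "(X\<^sub>0 has_vector_derivative E' (A' (T' (A' (E' (X\<^sub>0 s)))))) (at s within {0..})"
      using assms(15)[OF s] by (simp add: T_def)
  next
    show "S' (X\<^sub>0 0) = 0" using assms(16) S' by (simp add: N_iff)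
    show "X \<epsilon> 0 = X\<^sub>0 0" if "\<epsilon> > 0" for \<epsilon> using that by (rule assms(17))
  qed
  then show "(\<lambda>\<epsilon>. kms_norm \<sigma> (X \<epsilon> t - X\<^sub>0 t)) \<in> O[at_right 0](\<lambda>\<epsilon>. \<epsilon>)"
    by (simp add: kms_norm_eq)
qed

end
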